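(* Fix $X\in\mathbb{G}_\infty$ with variational series $(x_{(1)},x_{(2)},\dots)$. For $L=1,2,\dots$, let $Y\in\mathbb{G}_L$ be a random configuration with law $M^{(X)}_L$, and let $y_{(1)}(L),y_{(2)}(L),\dots$ be the terms of its variational series (which are random variables). Then for every fixed $k=1,2,\dots$, the probability of the event $y_{(k)}(L)=x_{(k)}$ tends to $1$ as $L\to\infty$.
   Context: Fix $q\in(0,1)$, $\zeta_-<0$, $\zeta_+>0$, and let $\mathfrak{L}=\{\zeta_-q^m:m\in\mathbb{Z}\}\sqcup\{\zeta_+q^n:n\in\mathbb{Z}\}\subset\mathbb{R}\setminus\{0\}$. A configuration is a subset of $\mathfrak{L}$; $\mathbb{G}_N$ ($N\ge1$) is the set of $N$-element configurations $X=(x_1<\dots<x_N)$; $\mathbb{G}_\infty$ is the set of all infinite configurations contained in a bounded segment of $\mathbb{R}$. Interlacing. For $a<b$ in $\mathfrak{L}$ put $I(a,b)=[a,b)\cap\mathfrak{L}$ if $a<b<0$; $I(a,b)=[a,b]\cap\mathfrak{L}$ if $a<0<b$; $I(a,b)=(a,b]\cap\mathfrak{L}$ if $0<a<b$. For $X\in\mathbb{G}_{N+1}$, $Y\in\mathbb{G}_N$ write $Y\prec X$ if $y_i\in I(x_i,x_{i+1})$ for $i=1,\dots,N$. $q$-links. $\Lambda^{N+1}_N$ is the stochastic matrix of format $\mathbb{G}_{N+1}\times\mathbb{G}_N$ with $$\Lambda^{N+1}_N(X,Y)=\prod_{i=1}^N|y_i|\cdot(1-q)\cdots(1-q^N)\cdot\frac{\prod_{1\le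 i<j\le N}(y_j-y_i)}{\prod_{1\le i<j\le N+1}(x_j-x_i)}$$ if $Y\prec X$, and $0$ otherwise. For $N>K$, $\Lambda^N_K=\Lambda^N_{N-1}\cdots\Lambda^{K+1}_K$. Variational series. For a bounded configuration $X$, its variational series $(x_{(1)},x_{(2)},\dots)$ lists its elements in decreasing order of absolute value (positive element first if two elements of opposite sign have the same absolute value), completed by $0$'s if $X$ is finite. A sequence $\{X(N)\in\mathbb{G}_N\}$ stabilizes to $X\in\mathbb{G}_\infty$ if for each $k$ the $k$-th term of the variational series of $X(N)$ equals $x_{(k)}$ for all large $N$. The measures $M^{(X)}_L$. For $X\in\mathbb{G}_\infty$, $M^{(X)}_L$ is the probability measure on $\mathbb{G}_L$ given by $M^{(X)}_L=\lim_{N\to\infty}\Lambda^N_L(X(N),\cdot)$ (weak limit), where $\{X(N)\}$ is any sequence stabilizing to $X$, e.g. $X(N)=\{x_{(1)},\dots,x_{(N)}\}$; this limit exists and does not depend on the choice of the sequence. *)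

theory Defs
  imports "HOL-Probability.Probability"
begin

definition lattice_pts :: "real \<Rightarrow> real \<Rightarrow> real \<Rightarrow> real set" where
  "lattice_pts q zm zp = range (\<lambda>m::int. zm * q powi m) \<union> range (\<lambda>n::int. zp * q powi n)"

definition G :: "real \<Rightarrow> real \<Rightarrow> real \<Rightarrow> nat \<Rightarrow> real set set" where
  "G q zm zp N = {X. X \<subseteq> lattice_pts q zm zp \<and> finite X \<and> card X = N}"

definition G_inf :: "real \<Rightarrow> real \<Rightarrow> real \<Rightarrow> real set set" where
  "G_inf q zm zp = {X. X \<subseteq> lattice_pts q zm zp \<and> infinite X \<and> bounded X}"

text \<open>The three cases are \<open>a < b < 0\<close>, \<open>a < 0 < b\<close> and \<open>0 < a < b\<close>;
  lattice points are never zero.\<close>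

definition lattice_interval :: "real \<Rightarrow> real \<Rightarrow> real \<Rightarrow> real \<Rightarrow> real \<Rightarrow> real set" where
  "lattice_interval q zm zp a b =
     (if b < 0 then {a..<b} else if a < 0 then {a..b} else {a<..b}) \<inter> lattice_pts q zm zp"

definition interlaces :: "real \<Rightarrow> real \<Rightarrow> real \<Rightarrow> nat \<Rightarrow> real set \<Rightarrow> real set \<Rightarrow> bool" where
  "interlaces q zm zp N Y X \<longleftrightarrow>
     Y \<in> G q zm zp N \<and> X \<in> G q zm zp (Suc N) \<and>
     (\<forall>i<N. sorted_list_of_set Y ! i \<in>
        lattice_interval q zm zp (sorted_list_of_set X ! i) (sorted_list_of_set X ! Suc i))"

definition vandermonde :: "real set \<Rightarrow> real" where
  "vandermonde X = (\<Prod>(a, b)\<in>{(a, b). a \<in> X \<and> b \<in> X \<and> a < b}. b - a)"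

text \<open>\<open>qlink q zm zp N\<close> is the matrix from level \<open>N + 1\<close> to level \<open>N\<close>.\<close>

definition qlink :: "real \<Rightarrow> real \<Rightarrow> real \<Rightarrow> nat \<Rightarrow> real set \<Rightarrow> real set \<Rightarrow> real" where
  "qlink q zm zp N X Y =
     (if interlaces q zm zp N Y X
      then (\<Prod>y\<in>Y. \<bar>y\<bar>) * (\<Prod>j=1..N. 1 - q ^ j) * (vandermonde Y / vandermonde X)
      else 0)"

text \<open>\<open>qlinks q zm zp N K\<close> is the matrix product of the one-step links from level \<open>N\<close> down to
  level \<open>K\<close>, for \<open>K < N\<close>. The value \<open>0\<close> when \<open>K \<ge> N\<close> is a dummy. The rows of the
  links can have infinitely many nonzero entries, hence the infinite sums.\<close>

primrec qlinks :: "real \<Rightarrow> real \<Rightarrow> real \<Rightarrow> nat \<Rightarrow> nat \<Rightarrow> real set \<Rightarrow> real set \<Rightarrow> real" where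
  "qlinks q zm zp 0 K X Y = 0"
| "qlinks q zm zp (Suc n) K X Y =
     (if n < K then 0
      else if n = K then qlink q zm zp K X Y
      else (\<Sum>\<^sub>\<infinity>Z\<in>G q zm zp n. qlink q zm zp n X Z * qlinks q zm zp n K Z Y))"

definition var_before :: "real \<Rightarrow> real \<Rightarrow> bool" where
  "var_before y x \<longleftrightarrow> \<bar>x\<bar> < \<bar>y\<bar> \<or> (\<bar>y\<bar> = \<bar>x\<bar> \<and> x \<le> y)"

text \<open>The \<open>k\<close>-th term, with \<open>k \<ge> 1\<close>, is the element of rank \<open>k\<close> in the order
  \<open>var_before\<close>. Since \<open>0\<close> is the only accumulation point of the lattice, a bounded
  configuration has finitely many elements before any given one, so the ranks are finite.\<close>

definition var_series :: "real set \<Rightarrow> nat \<Rightarrow> real" where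
  "var_series X k =
     (if finite X \<and> card X < k then 0
      else (THE x. x \<in> X \<and> card {y \<in> X. var_before y x} = k))"

definition stabilizes ::
    "real \<Rightarrow> real \<Rightarrow> real \<Rightarrow> (nat \<Rightarrow> real set) \<Rightarrow> real set \<Rightarrow> bool" where
  "stabilizes q zm zp Xs X \<longleftrightarrow>
     (\<forall>N\<ge>1. Xs N \<in> G q zm zp N) \<and>
     (\<forall>k\<ge>1. \<forall>\<^sub>F N in sequentially. var_series (Xs N) k = var_series X k)"

text \<open>Weak convergence of the mass functions \<open>p N\<close> on \<open>S\<close> to the law \<open>\<mu>\<close>, where \<open>S\<close>
  is discrete: every bounded function on \<open>S\<close> is a test function. The spaces of finite
  configurations are discrete because \<open>0\<close> is not a lattice point.\<close>

definition weakly_converges_on ::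
    "'a set \<Rightarrow> (nat \<Rightarrow> 'a \<Rightarrow> real) \<Rightarrow> 'a pmf \<Rightarrow> bool" where
  "weakly_converges_on S p \<mu> \<longleftrightarrow>
     (\<forall>f::'a \<Rightarrow> real. bounded (f ` S) \<longrightarrow>
        (\<lambda>N. \<Sum>\<^sub>\<infinity>Y\<in>S. p N Y * f Y) \<longlonglongrightarrow> measure_pmf.expectation \<mu> f)"

text \<open>\<open>is_M q zm zp X L \<mu>\<close> says that \<open>\<mu>\<close> is the measure \<open>M\<^sub>L\<close> attached to \<open>X\<close>. The limit
  does not depend on the stabilizing sequence, so it is enough that one such sequence
  yields \<open>\<mu>\<close>.\<close>

definition is_M :: "real \<Rightarrow> real \<Rightarrow> real \<Rightarrow> real set \<Rightarrow> nat \<Rightarrow> real set pmf \<Rightarrow> bool" where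
  "is_M q zm zp X L \<mu> \<longleftrightarrow>
     set_pmf \<mu> \<subseteq> G q zm zp L \<and>
     (\<exists>Xs. stabilizes q zm zp Xs X \<and>
        weakly_converges_on (G q zm zp L) (\<lambda>N. qlinks q zm zp N L (Xs N)) \<mu>)"

end

theory Submission
  imports Defs "Jordan_Normal_Form.Determinant"
begin

text \<open>
  The idea is to follow an initial segment of \<open>X\<close> through the links: a finite \<open>T \<subseteq> X\<close> that
  contains, with each point, everything of \<open>X\<close> that precedes it in the variational order. Such a set
  determines the first \<open>card T\<close> terms of the variational series of every configuration in which it
  is initial (\<open>var_series_eq_initial\<close>), so it suffices that the first \<open>k\<close> points of \<open>X\<close> form an
  initial segment of the random configuration at level \<open>L\<close> with probability tending to \<open>1\<close>.

  The reason is that one link from level \<open>n + 1\<close> to level \<open>n\<close> destroys an initial segment only with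
  exponentially small probability. Given a configuration with points \<open>x\<^sub>0 < \<dots> < x\<^sub>n\<close>, the
  interlacing configurations arise by choosing one point in each of the \<open>n\<close> disjoint slots
  \<open>I(x\<^sub>i, x\<^sub>i\<^sub>+\<^sub>1)\<close>, and the weight of a choice is the product of the \<open>\<bar>y\<^sub>i\<bar>\<close> times a
  Vandermonde product. A leading point \<open>x\<close> is an endpoint of its slot, of largest absolute value there. If
  another point \<open>v\<close> of that slot is chosen, then exchanging \<open>v\<close> for \<open>x\<close> multiplies the weight by
  \<open>\<bar>x\<bar> / \<bar>v\<bar>\<close> times the product of the ratios \<open>\<bar>x - r\<bar> / \<bar>v - r\<bar>\<close> over the other chosen
  points \<open>r\<close>. Because \<open>\<bar>v\<bar>\<close> is smaller than \<open>\<bar>x\<bar>\<close> by at least a factor \<open>q\<close>, or \<open>v\<close> has the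
  opposite sign, every \<open>r\<close> with \<open>\<bar>r\<bar> \<le> \<bar>x\<bar>\<close> contributes at least \<open>2 / (1 + q) > 1\<close>; at most \<open>card T\<close>
  of the points \<open>r\<close> are larger than \<open>x\<close> in absolute value, and each of these costs a bounded factor
  (\<open>prod_dist_ratio_le\<close>). Since exchanging is injective for each \<open>v\<close>, and the \<open>\<bar>v\<bar>\<close> have a finite
  sum over the slot, the leading point is lost with probability at most a constant times
  \<open>((1 + q) / 2)\<^sup>n\<close> (\<open>prob_top_point_missing\<close>).

  To iterate this bound the links have to be genuine Markov kernels. Their rows sum to \<open>1\<close>
  (\<open>has_sum_qlink\<close>) because the Vandermonde product is a determinant: summing it
  over independent choices replaces the entries of the \<open>i\<close>-th row by the geometric sums
  \<open>(x\<^sub>i\<^sub>+\<^sub>1\<^sup>j - x\<^sub>i\<^sup>j) / (1 - q\<^sup>j)\<close>, and the resulting determinant is again a Vandermonde product.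

  The losses of all links from level \<open>N\<close> down to level \<open>L\<close> add up to a geometric series, bounded
  by its tail from \<open>L\<close> on (\<open>ex_qlinks_pmf\<close>). The bound does not depend on \<open>N\<close>, so it passes to the
  weak limit \<open>M\<^sub>L\<close> (\<open>prob_M_not_initial\<close>), and the tail tends to \<open>0\<close> as \<open>L\<close> grows.
\<close>

section \<open>Vandermonde determinants\<close>

text \<open>The Vandermonde product of a sequence, in the order of the indices. For increasing sequences it is
  the product \<open>vandermonde\<close> of the set of values; the sequence version is the one that is a determinant.\<close>

definition vandermonde_seq :: "nat \<Rightarrow> (nat \<Rightarrow> 'a::comm_ring_1) \<Rightarrow> 'a" where
  "vandermonde_seq n y = (\<Prod>j<n. \<Prod>i<j. y j - y i)"

lemma vandermonde_seq_Suc_shift: "vandermonde_seq (Suc n) y =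
  (\<Prod>j<n. y (Suc j) - y 0) * vandermonde_seq n (\<lambda>i. y (Suc i))"
proof -
  have "vandermonde_seq (Suc n) y = (\<Prod>j<n. \<Prod>i<Suc j. y (Suc j) - y i)"
    unfolding vandermonde_seq_def by (subst prod.lessThan_Suc_shift) simp
  also have "\<dots> = (\<Prod>j<n. (y (Suc j) - y 0) * (\<Prod>i<j. y (Suc j) - y (Suc i)))"
    by (intro prod.cong refl, subst prod.lessThan_Suc_shift) simp
  finally show ?thesis by (simp add: vandermonde_seq_def prod.distrib)
qed

lemma det_first_row_unit:
  fixes A :: "'a::comm_ring_1 mat"
  assumes A: "A \<in> carrier_mat (Suc n) (Suc n)" and "A $$ (0, 0) = 1"
    and "\<And>j. j < n \<Longrightarrow> A $$ (0, Suc j) = 0"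
  shows "det A = det (mat n n (\<lambda>(i, j). A $$ (Suc i, Suc j)))"
proof -
  have "det A = (\<Sum>j<Suc n. A $$ (0, j) * cofactor A 0 j)"
    by (rule laplace_expansion_row[OF A]) simp
  also have "\<dots> = cofactor A 0 0"
    using assms by (subst sum.lessThan_Suc_shift) simp
  also have "mat_delete A 0 0 = mat n n (\<lambda>(i, j). A $$ (Suc i, Suc j))"
    using A by (intro eq_matI) (auto simp: mat_delete_def)
  then have "cofactor A 0 0 = det (mat n n (\<lambda>(i, j). A $$ (Suc i, Suc j)))"
    by (simp add: cofactor_def)
  finally show ?thesis .
qed

text \<open>Subtracting \<open>c\<close> times the preceding column from every column at once is multiplication by an
  upper unitriangular matrix. With the powers \<open>y\<^sub>i\<^sup>j\<close> and \<open>c = y\<^sub>0\<close> this clears the first row of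
  the Vandermonde matrix; with \<open>c = 1\<close> it turns values into increments.\<close>

lemma det_columns_minus_preceding:
  fixes a :: "nat \<Rightarrow> nat \<Rightarrow> 'a::comm_ring_1"
  shows "det (mat n n (\<lambda>(i, j). a i j - (if j = 0 then 0 else c * a i (j - 1)))) =
    det (mat n n (\<lambda>(i, j). a i j))"
proof -
  define A where "A = mat n n (\<lambda>(i, j). a i j)"
  define U where
    "U = mat n n (\<lambda>(i, j). if i = j then 1 else if Suc i = j then - c else (0::'a))"
  have cA: "A \<in> carrier_mat n n" and cU: "U \<in> carrier_mat n n" by (auto simp: A_def U_def)
  have "A * U = mat n n (\<lambda>(i, j). a i j - (if j = 0 then 0 else c * a i (j - 1)))"
  proof (rule eq_matI, goal_cases)
    case (1 i j)
    then have ij: "i < n" "j < n" by auto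
    have "(A * U) $$ (i, j) =
        (\<Sum>k = 0..<n. a i k * (if k = j then 1 else if Suc k = j then - c else 0))"
      using ij by (simp add: A_def U_def scalar_prod_def)
    also have "\<dots> = (\<Sum>k = 0..<n. (if k = j then a i k else 0) + 
        (if Suc k = j then - c * a i k else 0))"
      by (intro sum.cong) auto
    also have "\<dots> = a i j - (if j = 0 then 0 else c * a i (j - 1))"
      using ij by (cases j) (auto simp: sum.distrib)
    finally show ?case using ij by simp
  qed (auto simp: A_def U_def)
  moreover have "det (A * U) = det A * det U" by (rule det_mult[OF cA cU])
  moreover have "det U = prod_list (diag_mat U)"
    by (rule det_upper_triangular[OF _ cU]) (auto simp: U_def)
  moreover have "diag_mat U = replicate n 1"
    by (auto simp: diag_mat_def U_def intro!: nth_equalityI)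
  ultimately show ?thesis by (simp add: A_def)
qed

text \<open>Each term of the Leibniz expansion contains every row index and every column index exactly once.\<close>

lemma det_rows_scaled:
  fixes a :: "nat \<Rightarrow> nat \<Rightarrow> 'a::comm_ring_1"
  shows "det (mat n n (\<lambda>(i, j). r i * s j * a i j)) =
    (\<Prod>i<n. r i) * (\<Prod>j<n. s j) * det (mat n n (\<lambda>(i, j). a i j))"
proof -
  have "signof p * (\<Prod>i = 0..<n. r i * s (p i) * a i (p i)) =
      (\<Prod>i<n. r i) * (\<Prod>j<n. s j) * (signof p * (\<Prod>i = 0..<n. a i (p i)))"
    if "p permutes {0..<n}" for p
  proof -
    have "(\<Prod>i = 0..<n. s (p i)) = (\<Prod>j = 0..<n. s j)"
      using prod.permute[OF that, of s] by (simp add: o_def)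
    then show ?thesis by (simp add: prod.distrib mult_ac atLeast0LessThan)
  qed
  moreover have "p i < n" if "p permutes {0..<n}" "i < n" for p i
    using permutes_in_image[OF that(1), of i] that(2) by simp
  ultimately show ?thesis
    by (subst (1 2) det_def'[of _ n]) (auto simp: sum_distrib_left intro!: sum.cong)
qed

lemma det_vandermonde:
  fixes y :: "nat \<Rightarrow> 'a::comm_ring_1"
  shows "det (mat n n (\<lambda>(i, j). y i ^ j)) = vandermonde_seq n y"
proof (induction n arbitrary: y)
  case 0
  then show ?case by (simp add: vandermonde_seq_def)
next
  case (Suc n)
  let ?B = "mat (Suc n) (Suc n) (\<lambda>(i, j). y i ^ j - (if j = 0 then 0 else y 0 * y i ^ (j - 1)))"
  have "det (mat (Suc n) (Suc n) (\<lambda>(i, j). y i ^ j)) = det ?B"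
    by (rule det_columns_minus_preceding[of "Suc n" "\<lambda>i j. y i ^ j" "y 0", symmetric])
  also have "\<dots> = det (mat n n (\<lambda>(i, j). ?B $$ (Suc i, Suc j)))"
    by (rule det_first_row_unit) auto
  also have "mat n n (\<lambda>(i, j). ?B $$ (Suc i, Suc j)) =
      mat n n (\<lambda>(i, j). (y (Suc i) - y 0) * 1 * y (Suc i) ^ j)"
    by (intro cong_mat) (auto simp: algebra_simps)
  also have "det \<dots> = vandermonde_seq (Suc n) y"
    using Suc.IH[of "\<lambda>i. y (Suc i)"] by (subst det_rows_scaled) (simp add: vandermonde_seq_Suc_shift)
  finally show ?case .
qed

text \<open>In the transposed Vandermonde matrix of \<open>n + 1\<close> points the first row is constant, so passing to
  differences of neighbouring columns leaves a minor of size \<open>n\<close> with the increments of the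
  powers. These increments are what a geometric sum over a slot produces.\<close>

lemma det_vandermonde_increments:
  fixes x :: "nat \<Rightarrow> 'a::comm_ring_1"
  shows "det (mat n n (\<lambda>(i, j). x (Suc i) ^ Suc j - x i ^ Suc j)) = vandermonde_seq (Suc n) x"
proof -
  let ?B = "mat (Suc n) (Suc n)
    (\<lambda>(i, j). x j ^ i - (if j = 0 then 0 else 1 * x (j - 1) ^ i))"
  have "mat (Suc n) (Suc n) (\<lambda>(i, j). x j ^ i) = (mat (Suc n) (Suc n) (\<lambda>(i, j). x i ^ j))\<^sup>T"
    by (rule eq_matI) auto
  then have "vandermonde_seq (Suc n) x = det (mat (Suc n) (Suc n) (\<lambda>(i, j). x j ^ i))"
    by (simp add: det_transpose[of _ "Suc n"] det_vandermonde)
  also have "\<dots> = det ?B"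
    by (rule det_columns_minus_preceding[of "Suc n" "\<lambda>i j. x j ^ i" 1, symmetric])
  also have "\<dots> = det (mat n n (\<lambda>(i, j). ?B $$ (Suc i, Suc j)))"
    by (rule det_first_row_unit) auto
  also have "mat n n (\<lambda>(i, j). ?B $$ (Suc i, Suc j)) =
      (mat n n (\<lambda>(i, j). x (Suc i) ^ Suc j - x i ^ Suc j))\<^sup>T"
    by (rule eq_matI) auto
  also have "det \<dots> = det (mat n n (\<lambda>(i, j). x (Suc i) ^ Suc j - x i ^ Suc j))"
    by (rule det_transpose[of _ n]) simp
  finally show ?thesis by simp
qed

lemma vandermonde_image:
  assumes "\<And>i j. i < j \<Longrightarrow> j < n \<Longrightarrow> y i < y j"
  shows "vandermonde (y ` {..<n}) = vandermonde_seq n y"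
proof -
  have lt: "y i < y j \<longleftrightarrow> i < j" if "i < n" "j < n" for i j
    using assms[of i j] assms[of j i] that by (metis linorder_neqE_nat order_less_asym' order_less_irrefl)
  have inj: "y i = y j \<longleftrightarrow> i = j" if "i < n" "j < n" for i j
    using lt[OF that] lt[OF that(2,1)] by force
  have "vandermonde_seq n y = (\<Prod>(j, i)\<in>(SIGMA j:{..<n}. {..<j}). y j - y i)"
    unfolding vandermonde_seq_def by (rule prod.Sigma) auto
  also have "\<dots> = (\<Prod>p\<in>(SIGMA j:{..<n}. {..<j}). (\<lambda>(a, b). b - a) ((\<lambda>(j, i). (y i, y j)) p))"
    by (simp add: case_prod_unfold)
  also have "\<dots> = (\<Prod>(a, b)\<in>{(a, b). a \<in> y ` {..<n} \<and> b \<in> y ` {..<n} \<and> a < b}. b - a)"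
  proof (rule prod.reindex_bij_betw)
    show "bij_betw (\<lambda>(j, i). (y i, y j)) (SIGMA j:{..<n}. {..<j})
      {(a, b). a \<in> y ` {..<n} \<and> b \<in> y ` {..<n} \<and> a < b}"
      unfolding bij_betw_def
    proof
      show "inj_on (\<lambda>(j, i). (y i, y j)) (SIGMA j:{..<n}. {..<j})"
        by (auto simp: inj_on_def inj)
      show "(\<lambda>(j, i). (y i, y j)) ` (SIGMA j:{..<n}. {..<j}) =
        {(a, b). a \<in> y ` {..<n} \<and> b \<in> y ` {..<n} \<and> a < b}"
        using lt by (force simp: image_iff)
    qed
  qed
  finally show ?thesis by (simp add: vandermonde_def)
qed

lemma vandermonde_insert:
  assumes "finite R" "v \<notin> R"
  shows "vandermonde (insert v R) = vandermonde R * (\<Prod>r\<in>R. \<bar>v - r\<bar>)"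
proof -
  let ?P = "\<lambda>X. {(a::real, b). a \<in> X \<and> b \<in> X \<and> a < b}"
  let ?g = "\<lambda>r. (min v r, max v r)"
  have "?P R \<subseteq> R \<times> R" by auto
  then have fin: "finite (?P R)" using assms(1) by (auto intro: finite_subset)
  have inj: "inj_on ?g R" by (auto simp: inj_on_def min_def max_def split: if_splits)
  have eq: "?P (insert v R) = ?P R \<union> ?g ` R"
  proof (intro equalityI subsetI)
    fix p assume "p \<in> ?P (insert v R)"
    then obtain a b where p: "p = (a, b)" "a \<in> insert v R" "b \<in> insert v R" "a < b" by auto
    then consider "a \<in> R" "b \<in> R" | "a = v" "b \<in> R" | "b = v" "a \<in> R" by blast
    then show "p \<in> ?P R \<union> ?g ` R"
    proof cases
      case 1 then show ?thesis using p by auto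
    next
      case 2 then have "p = ?g b" using p by auto
      then show ?thesis using 2 by blast
    next
      case 3 then have "p = ?g a" using p by auto
      then show ?thesis using 3 by blast
    qed
  next
    fix p assume "p \<in> ?P R \<union> ?g ` R"
    then show "p \<in> ?P (insert v R)"
    proof
      assume "p \<in> ?g ` R"
      then obtain r where r: "r \<in> R" "p = ?g r" by blast
      then have "r \<noteq> v" using assms(2) by blast
      then show ?thesis using r by (auto simp: min_def max_def)
    qed auto
  qed
  have "?P R \<inter> ?g ` R = {}"
    using assms(2) by (auto simp: min_def max_def split: if_splits)
  then have "vandermonde (insert v R) = vandermonde R * (\<Prod>(a, b)\<in>?g ` R. b - a)"
    unfolding vandermonde_def eq using assms(1) fin by (subst prod.union_disjoint) auto
  also have "(\<Prod>(a, b)\<in>?g ` R. b - a) = (\<Prod>r\<in>R. \<bar>v - r\<bar>)"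
    by (subst prod.reindex[OF inj]) (auto intro!: prod.cong simp: min_def max_def)
  finally show ?thesis .
qed

lemma vandermonde_pos: "vandermonde X > 0"
  unfolding vandermonde_def by (intro prod_pos) auto

section \<open>Infinite sums and probability mass functions\<close>

text \<open>Only summability is at issue (\<open>infsum_prod_PiE_abs\<close> gives the value). If no
  factor has a vanishing sum of absolute values, the product of these sums is nonzero, and an
  infinite sum with a nonzero value is summable; otherwise every term is \<open>0\<close>.\<close>

lemma has_sum_prod_PiE:
  fixes f :: "'a \<Rightarrow> 'b \<Rightarrow> real"
  assumes "finite A" and hs: "\<And>x. x \<in> A \<Longrightarrow> (f x has_sum s x) (B x)"
  shows "((\<lambda>g. \<Prod>x\<in>A. f x (g x)) has_sum (\<Prod>x\<in>A. s x)) (PiE A B)"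
proof -
  have sm: "(\<lambda>v. norm (f x v)) summable_on B x" if "x \<in> A" for x
    using hs[OF that] by (metis has_sum_imp_summable summable_on_iff_abs_summable_on_real)
  have "(\<lambda>g. \<Prod>x\<in>A. norm (f x (g x))) summable_on PiE A B"
  proof (cases "\<exists>x\<in>A. infsum (\<lambda>v. norm (f x v)) (B x) = 0")
    case True
    then obtain x where x: "x \<in> A" "infsum (\<lambda>v. norm (f x v)) (B x) = 0" by blast
    have "norm (f x v) = 0" if "v \<in> B x" for v
      by (rule nonneg_infsum_le_0D) (use x sm that in auto)
    then have "(\<Prod>x\<in>A. norm (f x (g x))) = 0" if "g \<in> PiE A B" for g
      using x(1) that assms(1) by (intro prod_zero bexI[of _ x]) (auto simp: PiE_iff)
    then show ?thesis by (rule summable_on_0)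
  next
    case False
    have "infsum (\<lambda>g. \<Prod>x\<in>A. norm (f x (g x))) (PiE A B) =
        (\<Prod>x\<in>A. infsum (\<lambda>v. norm (f x v)) (B x))"
      by (rule infsum_prod_PiE_abs) (use assms(1) sm in auto)
    also have "\<dots> \<noteq> 0" using False assms(1) by simp
    finally show ?thesis using infsum_not_exists by blast
  qed
  then have "(\<lambda>g. \<Prod>x\<in>A. f x (g x)) summable_on PiE A B"
    by (subst summable_on_iff_abs_summable_on_real) (simp add: abs_prod)
  moreover have "infsum (\<lambda>g. \<Prod>x\<in>A. f x (g x)) (PiE A B) = (\<Prod>x\<in>A. s x)"
    by (rule trans[OF infsum_prod_PiE_abs[of A f B, OF assms(1) sm] prod.cong[OF refl infsumI[OF hs]]])
  ultimately show ?thesis using has_sum_infsum by metis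
qed

lemma has_sum_sum:
  fixes f :: "'i \<Rightarrow> 'a \<Rightarrow> real"
  assumes "finite P" and "\<And>p. p \<in> P \<Longrightarrow> (f p has_sum s p) A"
  shows "((\<lambda>y. \<Sum>p\<in>P. f p y) has_sum (\<Sum>p\<in>P. s p)) A"
  using assms by (induction P rule: finite_induct) (auto intro!: has_sum_add)

text \<open>In the Leibniz expansion of the Vandermonde determinant every term is a product of functions of
  the single \<open>y\<^sub>i\<close>, so summation over independent choices acts row by row. The hypothesis asks that
  the sums over \<open>I\<^sub>i\<close> be increments of powers of a common sequence \<open>x\<close>, up to column factors.\<close>

lemma has_sum_vandermonde_seq_PiE:
  fixes x :: "nat \<Rightarrow> real"
  assumes hs: "\<And>i j. i < n \<Longrightarrow> j < n \<Longrightarrow>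
    ((\<lambda>v. \<bar>v\<bar> * v ^ j) has_sum (x (Suc i) ^ Suc j - x i ^ Suc j) / d j) (I i)"
  shows "((\<lambda>y. (\<Prod>i<n. \<bar>y i\<bar>) * vandermonde_seq n y) has_sum vandermonde_seq (Suc n) x / (\<Prod>j<n. d j)) (PiE {..<n} I)"
proof -
  let ?P = "{p. p permutes {0..<n}}"
  let ?m = "\<lambda>i j. (x (Suc i) ^ Suc j - x i ^ Suc j) / d j"
  have lt: "p i < n" if "p \<in> ?P" "i < n" for p i
    using permutes_in_image[of p "{0..<n}" i] that by simp
  have "((\<lambda>y. \<Sum>p\<in>?P. signof p * (\<Prod>i<n. \<bar>y i\<bar> * y i ^ p i)) has_sum
      (\<Sum>p\<in>?P. signof p * (\<Prod>i<n. ?m i (p i)))) (PiE {..<n} I)"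
  proof (rule has_sum_sum)
    fix p assume p: "p \<in> ?P"
    have "((\<lambda>y. \<Prod>i\<in>{..<n}. \<bar>y i\<bar> * y i ^ p i) has_sum (\<Prod>i\<in>{..<n}. ?m i (p i))) (PiE {..<n} I)"
      by (rule has_sum_prod_PiE) (use hs lt[OF p] in auto)
    then show "((\<lambda>y. signof p * (\<Prod>i<n. \<bar>y i\<bar> * y i ^ p i)) has_sum
        signof p * (\<Prod>i<n. ?m i (p i))) (PiE {..<n} I)"
      by (rule has_sum_cmult_right)
  qed (simp add: finite_permutations)
  also have "(\<lambda>y::nat \<Rightarrow> real. \<Sum>p\<in>?P. signof p * (\<Prod>i<n. \<bar>y i\<bar> * y i ^ p i)) =
      (\<lambda>y. (\<Prod>i<n. \<bar>y i\<bar>) * vandermonde_seq n y)"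
  proof (rule ext)
    fix y :: "nat \<Rightarrow> real"
    have "vandermonde_seq n y = (\<Sum>p\<in>?P. signof p * (\<Prod>i<n. y i ^ p i))"
      unfolding det_vandermonde[symmetric] using lt
      by (subst det_def'[of _ n]) (auto simp: atLeast0LessThan intro!: sum.cong prod.cong)
    then show "(\<Sum>p\<in>?P. signof p * (\<Prod>i<n. \<bar>y i\<bar> * y i ^ p i)) = (\<Prod>i<n. \<bar>y i\<bar>) * vandermonde_seq n y"
      by (simp add: sum_distrib_left prod.distrib mult_ac)
  qed
  also have "(\<Sum>p\<in>?P. signof p * (\<Prod>i<n. ?m i (p i))) = det (mat n n (\<lambda>(i, j). ?m i j))"
    using lt by (subst det_def'[of _ n]) (auto simp: atLeast0LessThan intro!: sum.cong prod.cong)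
  also have "mat n n (\<lambda>(i, j). ?m i j) =
      mat n n (\<lambda>(i, j). 1 * inverse (d j) * (x (Suc i) ^ Suc j - x i ^ Suc j))"
    by (intro cong_mat) (auto simp: divide_simps)
  also have "det \<dots> = vandermonde_seq (Suc n) x / (\<Prod>j<n. d j)"
    unfolding det_rows_scaled[of n "\<lambda>_. 1" "\<lambda>j. inverse (d j)"] det_vandermonde_increments
    by (simp add: prod_inversef[symmetric] o_def divide_inverse)
  finally show ?thesis .
qed

lemma infsum_pmf_eq_expectation:
  fixes f :: "'a \<Rightarrow> real"
  assumes "set_pmf p \<subseteq> A" and "\<And>x. x \<in> set_pmf p \<Longrightarrow> \<bar>f x\<bar> \<le> B"
  shows "(\<Sum>\<^sub>\<infinity>x\<in>A. pmf p x * f x) = measure_pmf.expectation p f"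
proof -
  have "Infinite_Set_Sum.abs_summable_on (\<lambda>x. B * pmf p x) UNIV"
    using integrable_pmf[of UNIV p] by (auto simp: Infinite_Set_Sum.abs_summable_on_def)
  then have "Infinite_Set_Sum.abs_summable_on (\<lambda>x. pmf p x * f x) UNIV"
  proof (rule abs_summable_on_comparison_test)
    fix x
    show "norm (pmf p x * f x) \<le> norm (B * pmf p x)"
    proof (cases "x \<in> set_pmf p")
      case True
      then have "\<bar>f x\<bar> \<le> \<bar>B\<bar>" using assms(2)[OF True] by linarith
      then show ?thesis by (simp add: abs_mult mult.commute mult_right_mono)
    qed (simp add: set_pmf_iff)
  qed
  then have "measure_pmf.expectation p f = (\<Sum>\<^sub>\<infinity>x\<in>UNIV. pmf p x * f x)"
    by (simp add: pmf_expectation_eq_infsetsum infsetsum_infsum)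
  also have "\<dots> = (\<Sum>\<^sub>\<infinity>x\<in>A. pmf p x * f x)"
    using assms(1) by (intro infsum_cong_neutral) (auto simp: set_pmf_iff)
  finally show ?thesis ..
qed

lemma pmf_of_has_sum:
  assumes "\<And>x. 0 \<le> f x" and "(f has_sum 1) UNIV"
  shows "pmf (embed_pmf f) x = f x"
proof (rule pmf_embed_pmf)
  have "f summable_on UNIV" using assms(2) by (rule has_sum_imp_summable)
  then have "(\<lambda>x. norm (f x)) summable_on UNIV" using assms(1) by simp
  then have abs: "Infinite_Set_Sum.abs_summable_on f UNIV"
    using abs_summable_equivalent by blast
  have "infsetsum f UNIV = 1"
    using infsetsum_infsum[OF abs] assms(2) by (simp add: infsumI)
  with nn_integral_conv_infsetsum[OF abs] assms(1)
  show "(\<integral>\<^sup>+x. ennreal (f x) \<partial>count_space UNIV) = 1" by simp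
qed (use assms in auto)

text \<open>A comparison of masses by a change of one coordinate: \<open>g\<close> records what is given up and \<open>h\<close> the
  result. Since the pair is injective, the sum over \<open>A\<close> is dominated by the product of the sums
  of \<open>r\<close> and of the mass function, and the latter is at most \<open>1\<close>.\<close>

lemma prob_le_by_injection:
  assumes inj: "inj_on (\<lambda>a. (g a, h a)) A" and "g ` A \<subseteq> S"
    and bound: "\<And>a. a \<in> A \<Longrightarrow> pmf p a \<le> r (g a) * pmf p (h a)"
    and nonneg: "\<And>v. v \<in> S \<Longrightarrow> 0 \<le> r v" and "(r has_sum s) S"
  shows "measure_pmf.prob p A \<le> s"
proof -
  have abs: "Infinite_Set_Sum.abs_summable_on (pmf p) A"
    using integrable_pmf[of A p] by (simp add: Infinite_Set_Sum.abs_summable_on_def)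
  have "measure_pmf.prob p A = infsum (pmf p) A"
    by (simp add: measure_pmf_conv_infsetsum infsetsum_infsum[OF abs])
  also have "\<dots> \<le> s"
  proof (rule infsum_le_finite_sums)
    show "pmf p summable_on A"
      using abs abs_summable_equivalent[of "pmf p" A] by simp
    fix F assume F: "finite F" "F \<subseteq> A"
    have gF: "g a \<in> S" if "a \<in> F" for a using that F assms(2) by blast
    have "(\<Sum>a\<in>F. pmf p a) \<le> (\<Sum>a\<in>F. r (g a) * pmf p (h a))"
      using F bound by (intro sum_mono) auto
    also have "\<dots> = (\<Sum>(v, b)\<in>(\<lambda>a. (g a, h a)) ` F. r v * pmf p b)"
      using inj_on_subset[OF inj F(2)] by (simp add: sum.reindex)
    also have "\<dots> \<le> (\<Sum>(v, b)\<in>g ` F \<times> h ` F. r v * pmf p b)"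
      using F(1) nonneg gF by (intro sum_mono2) (auto intro!: mult_nonneg_nonneg)
    also have "\<dots> = (\<Sum>v\<in>g ` F. r v) * (\<Sum>b\<in>h ` F. pmf p b)"
      by (simp add: sum_product sum.cartesian_product)
    also have "\<dots> \<le> (\<Sum>v\<in>g ` F. r v) * 1"
      using F gF nonneg measure_measure_pmf_finite[of "h ` F" p] measure_pmf.prob_le_1[of p "h ` F"]
      by (intro mult_left_mono sum_nonneg) auto
    also have "\<dots> \<le> s"
      using finite_sum_le_has_sum[OF assms(5), of "g ` F"] F(1) gF nonneg by auto
    finally show "sum (pmf p) F \<le> s" .
  qed
  finally show ?thesis .
qed

section \<open>The lattice\<close>

locale q_lattice =
  fixes q zm zp :: real
  assumes q_pos: "0 < q" and q_less_1: "q < 1" and zm_neg: "zm < 0" and zp_pos: "0 < zp"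
begin

abbreviation "L \<equiv> lattice_pts q zm zp"
abbreviation "I \<equiv> lattice_interval q zm zp"

lemma lattice_nonzero: "x \<in> L \<Longrightarrow> x \<noteq> 0"
  using q_pos zm_neg zp_pos by (auto simp: lattice_pts_def)

lemma same_sign_lattice_pts:
  assumes "u \<in> L" "v \<in> L" "0 < u * v"
  obtains m :: int where "v = u * q powi m"
proof -
  have *: "\<exists>m::int. z * q powi b = z * q powi a * q powi m" for z and a b :: int
    using q_pos by (intro exI[of _ "b - a"]) (simp add: power_int_diff)
  have "zm * x < 0" "0 < zp * x" if "0 < x" for x
    using zm_neg zp_pos that by (auto simp: mult_neg_pos)
  then have sgn: "zm * q powi a < 0" "0 < zp * q powi a" for a :: int
    using q_pos by (auto simp: zero_less_power_int)
  obtain a z b w where ab: "u = z * q powi a" "v = w * q powi b" "z \<in> {zm, zp}" "w \<in> {zm, zp}"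
    using assms(1,2) unfolding lattice_pts_def by blast
  have "z = w"
  proof (rule ccontr)
    assume "z \<noteq> w"
    then have "u < 0 \<and> 0 < v \<or> 0 < u \<and> v < 0"
      using ab sgn by auto
    then have "u * v < 0" by (auto simp: mult_neg_pos mult_pos_neg)
    with assms(3) show False by simp
  qed
  then have "\<exists>m::int. v = u * q powi m"
    using * ab by blast
  then show thesis using that by blast
qed

lemma mult_q_power_in_lattice: "x \<in> L \<Longrightarrow> x * q ^ m \<in> L"
proof -
  have "z * q powi a * q ^ m = z * q powi (a + int m)" for z a
    using q_pos by (simp add: power_int_add)
  then show "x \<in> L \<Longrightarrow> x * q ^ m \<in> L" unfolding lattice_pts_def by fastforce
qed

text \<open>The lattice points of the sign of \<open>x\<close> between \<open>0\<close> and \<open>x\<close>, when \<open>x\<close> is a lattice point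
  (\<open>ray_eq\<close>). All slots are built from such rays.\<close>

definition ray :: "real \<Rightarrow> real set" where
  "ray x = range (\<lambda>m::nat. x * q ^ m)"

lemma ray_eq:
  assumes "x \<in> L"
  shows "ray x = {y \<in> L. 0 < y * x \<and> \<bar>y\<bar> \<le> \<bar>x\<bar>}"
proof (intro equalityI subsetI)
  fix y assume "y \<in> ray x"
  then obtain m where m: "y = x * q ^ m" by (auto simp: ray_def)
  have "q ^ m \<le> 1" using q_pos q_less_1 by (simp add: power_le_one)
  moreover have "0 < q ^ m" using q_pos by simp
  moreover have "0 < x * x" using lattice_nonzero[OF assms] by (simp add: zero_less_mult_iff) linarith
  ultimately have "0 < y * x" "\<bar>y\<bar> \<le> \<bar>x\<bar>"
    using mult_pos_pos[of "x * x" "q ^ m"] q_pos by (auto simp: m abs_mult mult_left_le mult_ac)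
  then show "y \<in> {y \<in> L. 0 < y * x \<and> \<bar>y\<bar> \<le> \<bar>x\<bar>}"
    using mult_q_power_in_lattice[OF assms] m by auto
next
  fix y assume y: "y \<in> {y \<in> L. 0 < y * x \<and> \<bar>y\<bar> \<le> \<bar>x\<bar>}"
  then obtain m :: int where m: "y = x * q powi m"
    using same_sign_lattice_pts[of x y] assms by (auto simp: mult.commute)
  have "\<bar>x\<bar> * q powi m \<le> \<bar>x\<bar>" using y q_pos by (simp add: m abs_mult power_int_abs)
  then have le: "q powi m \<le> 1" using lattice_nonzero[OF assms] by simp
  have "m \<ge> 0"
  proof (rule ccontr)
    assume "\<not> m \<ge> 0"
    then have "1 < inverse q ^ nat (- m)"
      using q_pos q_less_1 by (intro one_less_power) (auto simp: one_less_inverse)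
    also have "\<dots> = q powi m" using \<open>\<not> m \<ge> 0\<close> by (simp add: power_int_def)
    finally show False using le by simp
  qed
  then have "y = x * q ^ nat m" using m by (simp add: power_int_def)
  then show "y \<in> ray x" by (auto simp: ray_def)
qed

lemma lattice_gap:
  assumes "u \<in> L" "v \<in> L" "0 < u * v" "\<bar>u\<bar> < \<bar>v\<bar>"
  shows "\<bar>u\<bar> \<le> q * \<bar>v\<bar>"
proof -
  have "u \<in> ray v" using assms ray_eq by simp
  then obtain m where m: "u = v * q ^ m" by (auto simp: ray_def)
  with assms(4) obtain l where l: "m = Suc l" by (cases m) auto
  have "q ^ l \<le> 1" using q_pos q_less_1 by (simp add: power_le_one)
  then have "\<bar>v\<bar> * q * q ^ l \<le> \<bar>v\<bar> * q" using q_pos by (intro mult_left_le) auto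
  then show ?thesis using q_pos by (simp add: m l abs_mult mult_ac)
qed

lemma has_sum_ray:
  assumes "x \<in> L"
  shows "((\<lambda>v. \<bar>v\<bar> * v ^ j) has_sum sgn x * x ^ Suc j / (1 - q ^ Suc j)) (ray x)"
proof -
  have x0: "x \<noteq> 0" by (rule lattice_nonzero[OF assms])
  have ax: "\<bar>x\<bar> = sgn x * x" by (simp add: abs_sgn mult.commute)
  have inj: "inj (\<lambda>m::nat. x * q ^ m)"
    using x0 q_pos q_less_1 by (auto simp: inj_def power_inject_exp')
  have "(\<lambda>m. (q ^ Suc j) ^ m) sums (1 / (1 - q ^ Suc j))"
    using q_pos q_less_1 power_Suc_less_one[of q j] by (intro geometric_sums) simp
  then have "((\<lambda>m. (q ^ Suc j) ^ m) has_sum (1 / (1 - q ^ Suc j))) UNIV"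
    using q_pos by (intro sums_nonneg_imp_has_sum) auto
  from has_sum_cmult_right[OF this, of "sgn x * x ^ Suc j"]
  have "((\<lambda>m. sgn x * x ^ Suc j * (q ^ Suc j) ^ m) has_sum sgn x * x ^ Suc j / (1 - q ^ Suc j)) UNIV"
    by simp
  also have "(\<lambda>m. sgn x * x ^ Suc j * (q ^ Suc j) ^ m) = (\<lambda>v. \<bar>v\<bar> * v ^ j) \<circ> (\<lambda>m::nat. x * q ^ m)"
  proof
    fix m
    have "(q ^ j) ^ m = (q ^ m) ^ j"
      by (simp add: mult.commute flip: power_mult)
    then have "sgn x * x ^ Suc j * (q ^ Suc j) ^ m = (sgn x * x) * q ^ m * (x * q ^ m) ^ j"
      unfolding power_Suc power_mult_distrib by (simp only: mult_ac)
    also have "(sgn x * x) * q ^ m = \<bar>x * q ^ m\<bar>"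
      unfolding ax[symmetric] using q_pos by (simp add: abs_mult)
    finally show "sgn x * x ^ Suc j * (q ^ Suc j) ^ m = ((\<lambda>v. \<bar>v\<bar> * v ^ j) \<circ> (\<lambda>m::nat. x * q ^ m)) m"
      by simp
  qed
  finally show ?thesis unfolding ray_def by (subst has_sum_reindex[OF inj])
qed

text \<open>The three cases in the definition of an interval are a difference of two rays, a disjoint union of
  two rays, and again a difference. The sign of \<open>\<bar>v\<bar>\<close> relative to \<open>v\<close> is what makes the three
  results coincide, with no case distinction left.\<close>

lemma has_sum_lattice_interval:
  assumes "a \<in> L" "b \<in> L" "a < b"
  shows "((\<lambda>v. \<bar>v\<bar> * v ^ j) has_sum (b ^ Suc j - a ^ Suc j) / (1 - q ^ Suc j)) (I a b)"
proof -
  note ra = has_sum_ray[OF assms(1), of j] and rb = has_sum_ray[OF assms(2), of j]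
  note eqs = ray_eq[OF assms(1)] ray_eq[OF assms(2)]
  have nz: "y \<noteq> 0" if "y \<in> L" for y using lattice_nonzero[OF that] .
  consider "b < 0" | "a < 0" "0 < b" | "0 < a"
    using nz assms(1,2) by (meson linorder_less_linear)
  then show ?thesis
  proof cases
    case 1
    have "ray b \<subseteq> ray a" using 1 assms(3) unfolding eqs by (auto simp: zero_less_mult_iff)
    from has_sum_Diff[OF ra rb this] have "((\<lambda>v. \<bar>v\<bar> * v ^ j) has_sum
        (b ^ Suc j - a ^ Suc j) / (1 - q ^ Suc j)) (ray a - ray b)"
      using 1 assms(3) by (simp add: sgn_if diff_divide_distrib)
    also have "ray a - ray b = I a b"
      using 1 assms(3) unfolding eqs lattice_interval_def by (auto simp: zero_less_mult_iff)
    finally show ?thesis .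
  next
    case 2
    have "ray b \<inter> ray a = {}" using 2 unfolding eqs by (auto simp: zero_less_mult_iff)
    from has_sum_Un_disjoint[OF rb ra this] have "((\<lambda>v. \<bar>v\<bar> * v ^ j) has_sum
        (b ^ Suc j - a ^ Suc j) / (1 - q ^ Suc j)) (ray b \<union> ray a)"
      using 2 by (simp add: sgn_if diff_divide_distrib)
    also have "ray b \<union> ray a = I a b"
      using 2 nz unfolding eqs lattice_interval_def by (force simp: zero_less_mult_iff)
    finally show ?thesis .
  next
    case 3
    have "ray a \<subseteq> ray b" using 3 assms(3) unfolding eqs by (auto simp: zero_less_mult_iff)
    from has_sum_Diff[OF rb ra this] have "((\<lambda>v. \<bar>v\<bar> * v ^ j) has_sum
        (b ^ Suc j - a ^ Suc j) / (1 - q ^ Suc j)) (ray b - ray a)"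
      using 3 assms(3) by (simp add: sgn_if diff_divide_distrib)
    also have "ray b - ray a = I a b"
      using 3 assms(3) unfolding eqs lattice_interval_def by (auto simp: zero_less_mult_iff)
    finally show ?thesis .
  qed
qed

end

section \<open>One link as a random choice of slots\<close>

locale configuration = q_lattice +
  fixes n :: nat and X :: "real set"
  assumes X_in_G: "X \<in> G q zm zp (Suc n)"
begin

text \<open>Points of \<open>X\<close> are numbered from \<open>0\<close> to \<open>n\<close> in increasing order, slots from \<open>0\<close> to \<open>n - 1\<close>.\<close>

definition pt :: "nat \<Rightarrow> real" where "pt i = sorted_list_of_set X ! i"

definition slot :: "nat \<Rightarrow> real set" where "slot i = I (pt i) (pt (Suc i))"

definition choices :: "(nat \<Rightarrow> real) set" where "choices = PiE {..<n} slot"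

lemma X_facts: "finite X" "card X = Suc n" "X \<subseteq> L"
  using X_in_G by (auto simp: G_def)

lemma pt_less: "i < j \<Longrightarrow> j \<le> n \<Longrightarrow> pt i < pt j"
  using X_facts by (auto simp: pt_def intro!: sorted_wrt_nth_less[OF strict_sorted_list_of_set])

lemma pt_le: "i \<le> j \<Longrightarrow> j \<le> n \<Longrightarrow> pt i \<le> pt j"
  using pt_less[of i j] by (cases "i = j") auto

lemma X_eq: "X = pt ` {..<Suc n}"
proof -
  have "X = set (sorted_list_of_set X)" using X_facts by simp
  also have "\<dots> = pt ` {..<Suc n}" using X_facts by (auto simp: set_conv_nth pt_def image_iff) 
  finally show ?thesis .
qed

lemma pt_in_X: "i \<le> n \<Longrightarrow> pt i \<in> X"
  by (subst X_eq) auto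

lemma pt_in_L: "i \<le> n \<Longrightarrow> pt i \<in> L"
  using pt_in_X X_facts by blast

lemma pt_nonzero: "i \<le> n \<Longrightarrow> pt i \<noteq> 0"
  using pt_in_L lattice_nonzero by blast

lemma vandermonde_X: "vandermonde X = vandermonde_seq (Suc n) pt"
  by (subst X_eq, rule vandermonde_image) (use pt_less in auto)

text \<open>The half-open ends are recorded by signs: a slot contains its lower endpoint only if that is
  negative, and its upper endpoint only if that is positive. Hence neighbouring slots are disjoint.\<close>

lemma slot_bounds:
  assumes "v \<in> slot i"
  shows "v \<in> L" "pt i \<le> v" "v \<le> pt (Suc i)" "v = pt i \<Longrightarrow> pt i < 0" "v = pt (Suc i) \<Longrightarrow> 0 \<le> pt (Suc i)"
  using assms by (auto simp: slot_def lattice_interval_def split: if_splits)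

lemma slot_less:
  assumes "i < j" "j < n" "u \<in> slot i" "v \<in> slot j"
  shows "u < v"
  using slot_bounds[OF assms(3)] slot_bounds[OF assms(4)] pt_le[of "Suc i" j] assms(1,2) by force

lemma slot_unique: "i < n \<Longrightarrow> j < n \<Longrightarrow> v \<in> slot i \<Longrightarrow> v \<in> slot j \<Longrightarrow> i = j"
  using slot_less[of i j v v] slot_less[of j i v v] by (meson less_irrefl linorder_neqE_nat)

lemma choice_in_slot: "y \<in> choices \<Longrightarrow> i < n \<Longrightarrow> y i \<in> slot i"
  by (auto simp: choices_def)

lemma choice_less: "y \<in> choices \<Longrightarrow> i < j \<Longrightarrow> j < n \<Longrightarrow> y i < y j"
  using slot_less choice_in_slot by simp

lemma inj_on_choice: "y \<in> choices \<Longrightarrow> inj_on y {..<n}"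
  using choice_less[of y] by (intro linorder_inj_onI) (auto dest: less_imp_neq)

lemma sorted_list_choice:
  assumes "y \<in> choices"
  shows "sorted_list_of_set (y ` {..<n}) = map y [0..<n]"
proof -
  have "sorted_wrt (<) (map y [0..<n])"
    using choice_less[OF assms] by (auto simp: sorted_wrt_iff_nth_less)
  moreover have "set (map y [0..<n]) = y ` {..<n}" by (simp add: lessThan_atLeast0)
  moreover have "card (y ` {..<n}) = n" using inj_on_choice[OF assms] by (simp add: card_image)
  ultimately show ?thesis by (intro sorted_list_of_set_unique[THEN iffD1]) auto
qed

lemma interlaces_choice:
  assumes "y \<in> choices"
  shows "interlaces q zm zp n (y ` {..<n}) X"
proof -
  have "y ` {..<n} \<subseteq> L" using choice_in_slot[OF assms] slot_bounds(1) by blast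
  moreover have "card (y ` {..<n}) = n" using inj_on_choice[OF assms] by (simp add: card_image)
  ultimately show ?thesis
    using X_in_G choice_in_slot[OF assms]
    by (auto simp: interlaces_def G_def sorted_list_choice[OF assms] slot_def pt_def)
qed

text \<open>A configuration interlacing with \<open>X\<close> is the same as an independent choice of one point per slot,
  because such a choice is automatically increasing.\<close>

lemma bij_betw_choices:
  "bij_betw (\<lambda>y. y ` {..<n}) choices {Y. interlaces q zm zp n Y X}"
  unfolding bij_betw_def
proof
  show "inj_on (\<lambda>y. y ` {..<n}) choices"
  proof (rule inj_onI)
    fix y z assume yz: "y \<in> choices" "z \<in> choices" "y ` {..<n} = z ` {..<n}"
    then have "map y [0..<n] = map z [0..<n]"
      using sorted_list_choice by metis
    then have "y i = z i" if "i < n" for i using that by (simp add: map_eq_conv)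
    then show "y = z" using yz(1,2) unfolding choices_def by (intro PiE_ext) auto
  qed
  show "(\<lambda>y. y ` {..<n}) ` choices = {Y. interlaces q zm zp n Y X}"
  proof (intro equalityI subsetI)
    fix Y assume "Y \<in> {Y. interlaces q zm zp n Y X}"
    then have Y: "finite Y" "card Y = n"
      "\<forall>i<n. sorted_list_of_set Y ! i \<in> slot i"
      by (auto simp: interlaces_def G_def slot_def pt_def)
    define y where "y = (\<lambda>i\<in>{..<n}. sorted_list_of_set Y ! i)"
    have "y \<in> choices" using Y(3) by (auto simp: choices_def y_def)
    moreover have "Y = set (sorted_list_of_set Y)" using Y(1) by simp
    then have "Y = y ` {..<n}" using Y(2) by (auto simp: set_conv_nth y_def image_iff)
    ultimately show "Y \<in> (\<lambda>y. y ` {..<n}) ` choices" by blast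
  qed (auto simp: interlaces_choice)
qed

lemma qlink_choice:
  assumes "y \<in> choices"
  shows "qlink q zm zp n X (y ` {..<n}) =
    (\<Prod>i<n. \<bar>y i\<bar>) * vandermonde_seq n y * ((\<Prod>j=1..n. 1 - q ^ j) / vandermonde X)"
proof -
  have "vandermonde (y ` {..<n}) = vandermonde_seq n y"
    by (rule vandermonde_image) (rule choice_less[OF assms])
  moreover have "(\<Prod>v\<in>y ` {..<n}. \<bar>v\<bar>) = (\<Prod>i<n. \<bar>y i\<bar>)"
    by (simp add: prod.reindex[OF inj_on_choice[OF assms]])
  ultimately show ?thesis
    by (simp add: qlink_def interlaces_choice[OF assms])
qed

lemma q_factorial_pos: "(\<Prod>j=1..n. 1 - q ^ j) > 0"
proof (rule prod_pos)
  fix j assume "j \<in> {1..n}"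
  then have "q ^ j < 1" using q_pos q_less_1 by (intro power_less_one_iff[THEN iffD2]) auto
  then show "0 < 1 - q ^ j" by simp
qed

lemma qlink_nonneg: "0 \<le> qlink q zm zp n X Y"
proof -
  have "0 \<le> (\<Prod>v\<in>Y. \<bar>v\<bar>)" by (rule prod_nonneg) simp
  then show ?thesis
    using q_factorial_pos vandermonde_pos[of X] vandermonde_pos[of Y] by (simp add: qlink_def)
qed

text \<open>The rows of a link sum to \<open>1\<close>: the product of the \<open>1 - q\<^sup>j\<close> in its definition cancels the
  denominators of the geometric sums, and the Vandermonde product of \<open>X\<close> the determinant of increments.\<close>

lemma has_sum_qlink: "(qlink q zm zp n X has_sum 1) UNIV"
proof -
  let ?c = "(\<Prod>j=1..n. 1 - q ^ j) / vandermonde X"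
  have "(\<Prod>j<n. 1 - q ^ Suc j) = (\<Prod>j=1..n. 1 - q ^ j)"
    using prod.atLeast1_atMost_eq[of "\<lambda>j. 1 - q ^ j" n] by simp
  moreover have "((\<lambda>y. (\<Prod>i<n. \<bar>y i\<bar>) * vandermonde_seq n y) has_sum
      vandermonde_seq (Suc n) pt / (\<Prod>j<n. 1 - q ^ Suc j)) choices"
    unfolding choices_def
    by (rule has_sum_vandermonde_seq_PiE) (auto simp: slot_def simp del: power_Suc intro!: has_sum_lattice_interval pt_in_L pt_less)
  ultimately have "((\<lambda>y. (\<Prod>i<n. \<bar>y i\<bar>) * vandermonde_seq n y) has_sum
      vandermonde X / (\<Prod>j=1..n. 1 - q ^ j)) choices"
    by (simp add: vandermonde_X)
  from has_sum_cmult_left[OF this, of ?c]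
  have "((\<lambda>y. (\<Prod>i<n. \<bar>y i\<bar>) * vandermonde_seq n y * ?c) has_sum
      vandermonde X / (\<Prod>j=1..n. 1 - q ^ j) * ?c) choices" .
  also have "vandermonde X / (\<Prod>j=1..n. 1 - q ^ j) * ?c = 1"
    using less_imp_neq[OF q_factorial_pos] less_imp_neq[OF vandermonde_pos[of X]]
    by (simp only: times_divide_times_eq mult.commute) simp
  finally have "((\<lambda>y. (\<Prod>i<n. \<bar>y i\<bar>) * vandermonde_seq n y * ?c) has_sum 1) choices" .
  also have "?this \<longleftrightarrow> ((\<lambda>y. qlink q zm zp n X (y ` {..<n})) has_sum 1) choices"
    by (rule has_sum_cong) (simp add: qlink_choice)
  also have "\<dots> \<longleftrightarrow> (qlink q zm zp n X has_sum 1) {Y. interlaces q zm zp n Y X}"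
    by (rule has_sum_reindex_bij_betw[OF bij_betw_choices])
  also have "\<dots> \<longleftrightarrow> (qlink q zm zp n X has_sum 1) UNIV"
    by (rule has_sum_cong_neutral) (auto simp: qlink_def)
  finally show ?thesis .
qed

definition link_pmf :: "real set pmf" where
  "link_pmf = embed_pmf (qlink q zm zp n X)"

lemma pmf_link_pmf: "pmf link_pmf Y = qlink q zm zp n X Y"
  unfolding link_pmf_def by (rule pmf_of_has_sum[OF qlink_nonneg has_sum_qlink])

lemma set_link_pmf: "set_pmf link_pmf \<subseteq> {Y. interlaces q zm zp n Y X}"
  by (auto simp: set_pmf_iff pmf_link_pmf qlink_def split: if_splits)

end

section \<open>Initial segments and the variational series\<close>

text \<open>Down-sets of the variational order: \<open>T\<close> consists of the first \<open>card T\<close> points of \<open>Z\<close> when it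
  is finite. Working with such sets avoids the indices of the variational series.\<close>

definition initial :: "real set \<Rightarrow> real set \<Rightarrow> bool" where
  "initial T Z \<longleftrightarrow> T \<subseteq> Z \<and> (\<forall>t\<in>T. \<forall>z\<in>Z. var_before z t \<longrightarrow> z \<in> T)"

lemma var_before_refl: "var_before x x"
  by (simp add: var_before_def)

lemma var_before_trans: "var_before x y \<Longrightarrow> var_before y z \<Longrightarrow> var_before x z"
  by (auto simp: var_before_def)

lemma var_before_antisym: "var_before x y \<Longrightarrow> var_before y x \<Longrightarrow> x = y"
  by (auto simp: var_before_def)

lemma var_before_total: "var_before x y \<or> var_before y x"
  by (auto simp: var_before_def)

lemma initial_rank:
  assumes "initial T Z" "x \<in> T"
  shows "{y \<in> Z. var_before y x} = {y \<in> T. var_before y x}"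
  using assms by (auto simp: initial_def)

lemma rank_less:
  assumes "finite {y \<in> Z. var_before y z}" "z \<in> Z" "x \<noteq> z" "var_before x z"
  shows "card {y \<in> Z. var_before y x} < card {y \<in> Z. var_before y z}"
proof (rule psubset_card_mono[OF assms(1)])
  have "z \<notin> {y \<in> Z. var_before y x}" using assms var_before_antisym by blast
  moreover have "z \<in> {y \<in> Z. var_before y z}" using assms var_before_refl by blast
  ultimately show "{y \<in> Z. var_before y x} \<subset> {y \<in> Z. var_before y z}"
    using var_before_trans[OF _ assms(4)] by blast
qed

lemma inj_on_rank:
  assumes "finite T"
  shows "inj_on (\<lambda>x. card {y \<in> T. var_before y x}) T"
proof (rule inj_onI, rule ccontr)
  fix x z assume "x \<in> T" "z \<in> T" "card {y \<in> T. var_before y x} = card {y \<in> T. var_before y z}" "x \<noteq> z"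
  then show False
    using rank_less[of T z x] rank_less[of T x z] var_before_total[of x z] assms by fastforce
qed

text \<open>Within a finite set the rank is a bijection onto \<open>{1..card T}\<close>. Ranks in \<open>T\<close> and in \<open>Z\<close> agree
  on \<open>T\<close>, while a point of \<open>Z\<close> outside \<open>T\<close> comes after all of \<open>T\<close> and has a larger rank, or
  the cardinality \<open>0\<close> of an infinite set.\<close>

lemma var_series_initial:
  assumes T: "initial T Z" "finite T" and j: "1 \<le> j" "j \<le> card T"
  shows "var_series Z j \<in> T" and "card {y \<in> T. var_before y (var_series Z j)} = j"
proof -
  let ?r = "\<lambda>x. card {y \<in> T. var_before y x}"
  have "?r ` T \<subseteq> {1..card T}"
  proof (rule image_subsetI)
    fix x assume "x \<in> T"
    then have "{x} \<subseteq> {y \<in> T. var_before y x}" using var_before_refl by blast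
    then have "card {x} \<le> ?r x" using T(2) by (intro card_mono) auto
    moreover have "?r x \<le> card T" using T(2) by (intro card_mono) auto
    ultimately show "?r x \<in> {1..card T}" by simp
  qed
  then have "?r ` T = {1..card T}"
    using card_image[OF inj_on_rank[OF T(2)]] by (intro card_subset_eq) auto
  then obtain x where x: "x \<in> T" "?r x = j" using j by (metis (no_types, lifting) atLeastAtMost_iff imageE)
  have TZ: "T \<subseteq> Z" using T(1) by (simp add: initial_def)
  have "(THE x. x \<in> Z \<and> card {y \<in> Z. var_before y x} = j) = x"
  proof (rule the_equality)
    show "x \<in> Z \<and> card {y \<in> Z. var_before y x} = j"
      using x TZ initial_rank[OF T(1) x(1)] by auto
    fix z assume z: "z \<in> Z \<and> card {y \<in> Z. var_before y z} = j"
    have "z \<in> T"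
    proof (rule ccontr)
      assume "z \<notin> T"
      then have "var_before t z" if "t \<in> T" for t
        using T(1) z that var_before_total[of t z] by (auto simp: initial_def)
      then have "insert z T \<subseteq> {y \<in> Z. var_before y z}" using TZ z var_before_refl by blast
      \<comment> \<open>an infinite set has cardinality \<open>0\<close>, whereas \<open>j \<ge> 1\<close>\<close>
      moreover have "finite {y \<in> Z. var_before y z}" using z j(1) by (metis card.infinite not_one_le_zero)
      ultimately have "card (insert z T) \<le> j" using z card_mono by metis
      then show False using \<open>z \<notin> T\<close> T(2) j(2) by simp
    qed
    then show "z = x"
      using z x initial_rank[OF T(1)] inj_on_rank[OF T(2)] by (auto simp: inj_on_def)
  qed
  moreover have "\<not> (finite Z \<and> card Z < j)"
    using card_mono[OF _ TZ] j(2) by auto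
  ultimately have "var_series Z j = x" unfolding var_series_def by (simp only: if_False)
  then show "var_series Z j \<in> T" "?r (var_series Z j) = j" using x by auto
qed

lemma var_series_eq_initial:
  assumes T: "initial T Z" "finite T" and j: "1 \<le> j" "j \<le> card T"
  shows "var_series Z j = var_series T j"
proof -
  have "initial T T" by (simp add: initial_def)
  then show ?thesis
    using var_series_initial[OF T j] var_series_initial[of T T j] T(2) j inj_on_rank[OF T(2)]
    by (auto simp: inj_on_def)
qed

lemma initial_eq_var_series_image:
  assumes T: "initial T Z" "finite T"
  shows "T = var_series Z ` {1..card T}"
proof (rule sym, rule card_subset_eq[OF T(2)])
  show "var_series Z ` {1..card T} \<subseteq> T" using var_series_initial(1)[OF T] by auto
  have "inj_on (var_series Z) {1..card T}"
    by (rule inj_on_inverseI[where g = "\<lambda>x. card {y \<in> T. var_before y x}"])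
      (use var_series_initial(2)[OF T] in auto)
  then show "card (var_series Z ` {1..card T}) = card T" by (simp add: card_image)
qed

text \<open>Greedy construction: an initial segment is extended by a remaining point of least rank.\<close>

lemma ex_initial:
  assumes "\<And>x. x \<in> Z \<Longrightarrow> finite {y \<in> Z. var_before y x}" and "finite Z \<Longrightarrow> k \<le> card Z"
  shows "\<exists>T. initial T Z \<and> finite T \<and> card T = k"
  using assms(2)
proof (induction k)
  case 0
  have "initial {} Z" by (simp add: initial_def)
  then show ?case by (intro exI[of _ "{}"]) simp
next
  case (Suc k)
  from Suc.prems have "finite Z \<Longrightarrow> k \<le> card Z" by simp
  then obtain T where T: "initial T Z" "finite T" "card T = k" using Suc.IH by blast
  have "Z \<noteq> T" using Suc.prems T by auto
  then have "\<exists>z. z \<in> Z - T" using T(1) by (auto simp: initial_def)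
  then obtain z where z: "z \<in> Z - T" and
    min: "\<And>y. y \<in> Z - T \<Longrightarrow> card {u \<in> Z. var_before u z} \<le> card {u \<in> Z. var_before u y}"
    using ex_has_least_nat[of "\<lambda>z. z \<in> Z - T" _ "\<lambda>z. card {u \<in> Z. var_before u z}"] by blast
  have "y \<in> insert z T" if "y \<in> Z" "var_before y z" for y
  proof (rule ccontr)
    assume "y \<notin> insert z T"
    then show False using min[of y] rank_less[OF assms(1), of z y] that z by auto
  qed
  then have "initial (insert z T) Z" using T(1) z by (auto simp: initial_def)
  then show ?case using T z by (intro exI[of _ "insert z T"]) simp
qed

context q_lattice
begin

lemma finite_ray_away_from_0:
  assumes "0 < e"
  shows "finite {y \<in> ray x. e \<le> \<bar>y\<bar>}"
proof -
  have "(\<lambda>m. \<bar>x * q ^ m\<bar>) \<longlonglongrightarrow> \<bar>x * 0\<bar>"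
    using q_pos q_less_1 by (intro tendsto_intros LIMSEQ_power_zero) auto
  then have "\<forall>\<^sub>F m in sequentially. \<bar>x * q ^ m\<bar> < e"
    using assms by (intro order_tendstoD) auto
  then obtain M where M: "\<And>m. m \<ge> M \<Longrightarrow> \<bar>x * q ^ m\<bar> < e"
    by (auto simp: eventually_sequentially)
  have "{y \<in> ray x. e \<le> \<bar>y\<bar>} \<subseteq> (\<lambda>m. x * q ^ m) ` {..<M}"
  proof
    fix y assume "y \<in> {y \<in> ray x. e \<le> \<bar>y\<bar>}"
    then obtain m where m: "y = x * q ^ m" "e \<le> \<bar>x * q ^ m\<bar>" by (auto simp: ray_def)
    then have "m < M" using M[of m] by (meson leD linorder_le_less_linear)
    then show "y \<in> (\<lambda>m. x * q ^ m) ` {..<M}" using m by blast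
  qed
  then show ?thesis by (rule finite_subset) simp
qed

text \<open>Bounded lattice configurations accumulate only at \<open>0\<close>, so every rank in the variational order is
  finite. The points in question lie on two rays that start beyond the bound.\<close>

lemma finite_before:
  assumes X: "X \<subseteq> L" "bounded X" and x: "x \<in> X"
  shows "finite {y \<in> X. var_before y x}"
proof -
  obtain B where B: "\<And>y. y \<in> X \<Longrightarrow> \<bar>y\<bar> \<le> B"
    using X(2) by (auto simp: bounded_iff)
  have big: "\<exists>w\<in>L. 0 < w * z \<and> B \<le> \<bar>w\<bar>" if "z \<in> {zm, zp}" for z
  proof -
    have z: "z \<noteq> 0" using that zm_neg zp_pos by auto
    obtain m where m: "B / \<bar>z\<bar> < (1 / q) ^ m"
      using real_arch_pow[of "1 / q" "B / \<bar>z\<bar>"] q_pos q_less_1 by auto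
    have "z * q powi (- int m) \<in> L" using that by (auto simp: lattice_pts_def)
    moreover have e: "z * q powi (- int m) = z * (1 / q) ^ m"
      by (simp add: power_int_minus power_inverse divide_inverse)
    moreover have "0 < z * z" using z not_real_square_gt_zero[of z] by blast
    then have "0 < (z * z) * (1 / q) ^ m"
      by (rule mult_pos_pos) (use q_pos in simp)
    moreover have "B \<le> \<bar>z * (1 / q) ^ m\<bar>"
      using m z q_pos by (simp add: abs_mult field_simps)
    ultimately show ?thesis
      by (intro bexI[of _ "z * q powi (- int m)"]) (auto simp: mult_ac)
  qed
  obtain wm wp where w: "wm \<in> L" "0 < wm * zm" "B \<le> \<bar>wm\<bar>" "wp \<in> L" "0 < wp * zp" "B \<le> \<bar>wp\<bar>"
    using big[of zm] big[of zp] by auto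
  have "{y \<in> X. var_before y x} \<subseteq> {y \<in> ray wm. \<bar>x\<bar> \<le> \<bar>y\<bar>} \<union> {y \<in> ray wp. \<bar>x\<bar> \<le> \<bar>y\<bar>}"
  proof
    fix y assume y: "y \<in> {y \<in> X. var_before y x}"
    then have "y \<noteq> 0" "y \<in> L" using X(1) lattice_nonzero by auto
    moreover have "\<bar>x\<bar> \<le> \<bar>y\<bar>" using y by (auto simp: var_before_def)
    moreover have "\<bar>y\<bar> \<le> \<bar>wm\<bar>" "\<bar>y\<bar> \<le> \<bar>wp\<bar>" using B[of y] y w by auto
    moreover have "wm < 0" "0 < wp" using w zm_neg zp_pos by (auto simp: zero_less_mult_iff)
    ultimately show "y \<in> {y \<in> ray wm. \<bar>x\<bar> \<le> \<bar>y\<bar>} \<union> {y \<in> ray wp. \<bar>x\<bar> \<le> \<bar>y\<bar>}"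
      unfolding ray_eq[OF w(1)] ray_eq[OF w(4)] by (auto simp: zero_less_mult_iff)
  qed
  moreover have "0 < \<bar>x\<bar>" using x X(1) lattice_nonzero by auto
  ultimately show ?thesis
    using finite_ray_away_from_0 by (meson finite_UnI finite_subset)
qed

end

section \<open>One link keeps the leading points\<close>

text \<open>For \<open>\<bar>r\<bar> \<le> x\<close> and \<open>r < v\<close> the ratio \<open>(v - r) / (x - r)\<close> decreases in \<open>r\<close>, so it is largest at
  \<open>r = - x\<close>, where it is at most \<open>(1 + q) / 2\<close>. For \<open>r < - x\<close> the ratio is still at most \<open>1\<close>, and
  for \<open>r \<ge> x / q\<close> the distance \<open>r - x\<close> is at least \<open>(1 - q) r\<close>, which gives \<open>2 / (1 - q)\<close>.\<close>

lemma prod_dist_ratio_le: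
  fixes q x v :: real
  assumes q: "0 < q" "q < 1" and x: "0 < x" "v \<le> q * x" "\<bar>v\<bar> \<le> x" and "finite R"
    and R: "\<And>r. r \<in> R \<Longrightarrow> r < v \<or> x \<le> q * r"
    and k: "card {r \<in> R. x < \<bar>r\<bar>} \<le> k"
  shows "(\<Prod>r\<in>R. \<bar>v - r\<bar>) \<le>
    (2 / (1 - q)) ^ k * ((1 + q) / 2) ^ (card R - k) * (\<Prod>r\<in>R. \<bar>x - r\<bar>)"
proof -
  define c where "c = (1 + q) / 2"
  define C where "C = 2 / (1 - q)"
  have c: "0 < c" "c < 1" and C: "1 \<le> C" using q by (auto simp: c_def C_def field_simps)
  define w where "w = (\<lambda>r. if x < \<bar>r\<bar> then C else c)"
  have pointwise: "\<bar>v - r\<bar> \<le> w r * \<bar>x - r\<bar>" if "r \<in> R" for r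
    using R[OF that]
  proof
    assume r: "r < v"
    show ?thesis
    proof (cases "x < \<bar>r\<bar>")
      case True
      have "v - r \<le> 1 * (x - r)" using x by simp
      also have "\<dots> \<le> C * (x - r)" using C r x by (intro mult_right_mono) auto
      finally show ?thesis using r x(2) \<open>v - r \<le> 1 * (x - r)\<close> unfolding w_def if_P[OF True] by simp
    next
      case False
      have "0 \<le> (1 - c) * (x + r)" using c False by (intro mult_nonneg_nonneg) auto
      then have "v - r \<le> c * (x - r)" using x(2) by (simp add: c_def field_simps)
      then show ?thesis using r x unfolding w_def if_not_P[OF False] by simp
    qed
  next
    assume r: "x \<le> q * r"
    have "0 < q * r" using r x by linarith
    then have r0: "0 < r" using q by (simp add: zero_less_mult_iff)
    have "q * r < r" using q r0 by simp
    then have xr: "x < r" using r by linarith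
    have "\<bar>v - r\<bar> \<le> 2 * r" using x xr by linarith
    also have "\<dots> = C * ((1 - q) * r)" using q by (simp add: C_def)
    also have "\<dots> \<le> C * (r - x)" using C r by (intro mult_left_mono) (auto simp: algebra_simps)
    finally show ?thesis using xr r0 by (simp add: w_def)
  qed
  define a where "a = card {r \<in> R. x < \<bar>r\<bar>}"
  have "(\<Prod>r\<in>R. \<bar>v - r\<bar>) \<le> (\<Prod>r\<in>R. w r * \<bar>x - r\<bar>)"
    by (rule prod_mono) (use pointwise in auto)
  also have "\<dots> = (\<Prod>r\<in>R. w r) * (\<Prod>r\<in>R. \<bar>x - r\<bar>)" by (rule prod.distrib)
  also have "(\<Prod>r\<in>R. w r) = C ^ a * c ^ card (R - {r \<in> R. x < \<bar>r\<bar>})"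
    unfolding w_def prod.If_cases[OF \<open>finite R\<close>] a_def
    by (auto simp: Int_def Diff_eq intro!: arg_cong2[where f = "(*)"] arg_cong[where f = "\<lambda>A. _ ^ card A"])
  also have "card (R - {r \<in> R. x < \<bar>r\<bar>}) = card R - a"
    unfolding a_def using \<open>finite R\<close> by (intro card_Diff_subset) auto
  also have "C ^ a * c ^ (card R - a) * (\<Prod>r\<in>R. \<bar>x - r\<bar>) \<le>
      C ^ k * c ^ (card R - k) * (\<Prod>r\<in>R. \<bar>x - r\<bar>)"
    using c C k unfolding a_def
    by (intro mult_right_mono mult_mono power_increasing power_decreasing prod_nonneg) auto
  finally show ?thesis by (simp add: c_def C_def)
qed

context configuration
begin

lemma in_X_iff: "z \<in> X \<longleftrightarrow> (\<exists>m\<le>n. z = pt m)"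
  by (subst X_eq) (auto simp: less_Suc_eq_le)

text \<open>A slot contains whichever of its endpoints lies on the same side of \<open>0\<close> as the given point and
  at least as far from \<open>0\<close>. This lets points of \<open>Y\<close> be charged injectively to points of \<open>X\<close> that precede
  them.\<close>

lemma slot_contains_earlier_endpoint:
  assumes "i < n" "v \<in> slot i"
  shows "\<exists>e\<in>X \<inter> slot i. var_before e v"
proof -
  have i: "i \<le> n" "Suc i \<le> n" using assms by auto
  have lt: "pt i < pt (Suc i)" using assms(1) by (intro pt_less) auto
  have v: "v \<in> L" "v \<noteq> 0" using slot_bounds(1)[OF assms(2)] lattice_nonzero by auto
  note bnd = slot_bounds(2,3)[OF assms(2)]
  have mem: "pt i \<in> L" "pt (Suc i) \<in> L" using pt_in_L i by auto
  consider "pt i < 0" "v < 0" | "0 < v" "0 < pt (Suc i)"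
    using v(2) bnd pt_nonzero[OF i(1)] assms(2)
    unfolding slot_def lattice_interval_def by (cases "v < 0") (auto split: if_splits)
  then have "(pt i \<in> slot i \<and> var_before (pt i) v) \<or> (pt (Suc i) \<in> slot i \<and> var_before (pt (Suc i)) v)"
  proof cases
    case 1
    then have "pt i \<in> slot i" using lt mem by (auto simp: slot_def lattice_interval_def)
    then show ?thesis using 1 bnd by (auto simp: var_before_def)
  next
    case 2
    then have "pt (Suc i) \<in> slot i" using lt mem by (auto simp: slot_def lattice_interval_def)
    then show ?thesis using 2 bnd by (auto simp: var_before_def)
  qed
  then show ?thesis using pt_in_X[OF i(1)] pt_in_X[OF i(2)] by blast
qed

text \<open>A point of \<open>Y\<close> that precedes a point of \<open>T\<close> is itself preceded by an endpoint in its slot, which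
  therefore lies in \<open>T \<subseteq> Y\<close>; as \<open>Y\<close> has just one point in each slot, the two coincide.\<close>

lemma initial_if_subset:
  assumes T: "initial T X" and Y: "interlaces q zm zp n Y X" and "T \<subseteq> Y"
  shows "initial T Y"
  unfolding initial_def
proof (intro conjI ballI impI)
  fix t z assume t: "t \<in> T" and z: "z \<in> Y" "var_before z t"
  obtain y where y: "y \<in> choices" "Y = y ` {..<n}"
    using Y bij_betw_choices unfolding bij_betw_def by blast
  obtain j where j: "j < n" "z = y j" using z y by auto
  obtain e where e: "e \<in> X" "e \<in> slot j" "var_before e z"
    using slot_contains_earlier_endpoint[OF j(1)] choice_in_slot[OF y(1) j(1)] j(2) by blast
  have "e \<in> T" using T e t var_before_trans[OF e(3) z(2)] by (auto simp: initial_def)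
  then obtain l where l: "l < n" "e = y l" using \<open>T \<subseteq> Y\<close> y by auto
  have "l = j" using slot_unique[OF l(1) j(1)] choice_in_slot[OF y(1) l(1)] e(2) l(2) by simp
  then show "z \<in> T" using \<open>e \<in> T\<close> l j by simp
qed (rule assms(3))

text \<open>A leading point is the dominant endpoint of a slot that contains it. This could fail only for the
  last point of \<open>X\<close> in the variational order, which is an extreme or one of the two points
  next to \<open>0\<close>; but if that point were in \<open>T\<close>, all of \<open>X\<close> would be.\<close>

lemma slot_of_top_point:
  assumes T: "initial T X" "card T < card X" and "x \<in> T"
  obtains i where "i < n" "x \<in> slot i" "\<bar>pt i\<bar> \<le> \<bar>x\<bar>" "\<bar>pt (Suc i)\<bar> \<le> \<bar>x\<bar>"
    "(0 < x \<and> x = pt (Suc i)) \<or> (x < 0 \<and> x = pt i)"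
proof -
  have notall: "\<not> (\<forall>z\<in>X. var_before z x)"
  proof
    assume "\<forall>z\<in>X. var_before z x"
    then have "X \<subseteq> T" using T(1) \<open>x \<in> T\<close> by (auto simp: initial_def)
    then have "X = T" using T(1) by (auto simp: initial_def)
    then show False using T(2) by simp
  qed
  have xX: "x \<in> X" using T(1) \<open>x \<in> T\<close> by (auto simp: initial_def)
  then obtain m where m: "m \<le> n" "x = pt m" using in_X_iff by blast
  have x0: "x \<noteq> 0" using m pt_nonzero by simp
  then consider "0 < x" | "x < 0" by linarith
  then show thesis
  proof cases
    case 1
    have "m \<noteq> 0"
    proof
      assume "m = 0"
      then have "\<forall>z\<in>X. var_before z x" using pt_le[of 0] m 1
        by (force simp: in_X_iff var_before_def)
      then show False using notall by blast
    qed
    then obtain i where i: "m = Suc i" by (cases m) auto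
    have "- x \<le> pt i"
    proof (rule ccontr)
      assume "\<not> - x \<le> pt i"
      moreover have "pt j \<le> pt i \<or> x \<le> pt j" if "j \<le> n" for j
        using pt_le[of j i] pt_le[of m j] m i that by (cases "j \<le> i") auto
      ultimately have "\<forall>z\<in>X. var_before z x" using 1
        by (force simp: in_X_iff var_before_def)
      then show False using notall by blast
    qed
    moreover have "pt i < x" using pt_less[of i m] m i by simp
    moreover have "x \<in> slot i" using m i 1 \<open>pt i < x\<close> pt_in_L[of m] by (simp add: slot_def lattice_interval_def)
    ultimately show thesis using that[of i] m i 1 by simp
  next
    case 2
    have "m \<noteq> n"
    proof
      assume "m = n"
      then have "z \<le> x" if "z \<in> X" for z using pt_le[of _ n] m that by (auto simp: in_X_iff)
      then have "\<forall>z\<in>X. var_before z x" using 2 by (force simp: var_before_def)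
      then show False using notall by blast
    qed
    then have i: "m < n" using m by simp
    have "pt (Suc m) \<le> - x"
    proof (rule ccontr)
      assume "\<not> pt (Suc m) \<le> - x"
      moreover have "pt j \<le> x \<or> pt (Suc m) \<le> pt j" if "j \<le> n" for j
        using pt_le[of j m] pt_le[of "Suc m" j] m i that by (cases "j \<le> m") auto
      ultimately have "\<forall>z\<in>X. var_before z x" using 2
        by (force simp: in_X_iff var_before_def)
      then show False using notall by blast
    qed
    moreover have "x < pt (Suc m)" using pt_less[of m "Suc m"] m i by simp
    moreover have "x \<in> slot m" using m 2 \<open>x < pt (Suc m)\<close> pt_in_L[of m] by (simp add: slot_def lattice_interval_def)
    ultimately show thesis using that[of m] m i 2 by simp
  qed
qed

lemma card_larger_le:
  assumes T: "initial T X" and "x \<in> T" and "y \<in> choices" and "R \<subseteq> y ` {..<n}"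
  shows "card {r \<in> R. \<bar>x\<bar> < \<bar>r\<bar>} \<le> card T"
proof -
  have finT: "finite T" using T X_facts(1) by (auto simp: initial_def intro: finite_subset)
  have "\<exists>e. \<exists>j<n. r = y j \<and> e \<in> slot j \<and> e \<in> T" if r: "r \<in> R" "\<bar>x\<bar> < \<bar>r\<bar>" for r
  proof -
    obtain j where j: "j < n" "r = y j" using assms(4) r by auto
    obtain e where e: "e \<in> X" "e \<in> slot j" "var_before e r"
      using slot_contains_earlier_endpoint[OF j(1)] choice_in_slot[OF assms(3) j(1)] j(2) by blast
    have "var_before r x" using r by (simp add: var_before_def)
    then have "e \<in> T" using T \<open>x \<in> T\<close> e var_before_trans by (auto simp: initial_def)
    then show ?thesis using j e by blast
  qed
  then obtain f where f: "\<And>r. r \<in> R \<Longrightarrow> \<bar>x\<bar> < \<bar>r\<bar> \<Longrightarrow> \<exists>j<n. r = y j \<and> f r \<in> slot j \<and> f r \<in> T"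
    by metis
  show ?thesis
  proof (rule card_inj_on_le[of f])
    show "inj_on f {r \<in> R. \<bar>x\<bar> < \<bar>r\<bar>}"
      by (rule inj_onI) (use f slot_unique in \<open>metis (no_types, lifting) mem_Collect_eq\<close>)
    show "f ` {r \<in> R. \<bar>x\<bar> < \<bar>r\<bar>} \<subseteq> T" using f by blast
  qed (rule finT)
qed

text \<open>Every configuration without \<open>x\<close> has another point \<open>v\<close> in the slot of \<open>x\<close>. Exchanging \<open>v\<close> for
  \<open>x\<close> is compared by \<open>prob_le_by_injection\<close>, with a ratio of masses proportional to \<open>\<bar>v\<bar>\<close>; the
  sum of \<open>\<bar>v\<bar>\<close> over the slot is its length divided by \<open>1 - q\<close>, that is at most
  \<open>2 \<bar>x\<bar> / (1 - q)\<close>.\<close>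

lemma prob_top_point_missing:
  assumes T: "initial T X" "card T < n" and "x \<in> T"
  shows "measure_pmf.prob link_pmf {Y. x \<notin> Y} \<le>
    2 / (1 - q) * (2 / (1 - q)) ^ card T * ((1 + q) / 2) ^ (n - 1 - card T)"
proof -
  define K where "K = (2 / (1 - q)) ^ card T * ((1 + q) / 2) ^ (n - 1 - card T)"
  have K: "0 \<le> K" using q_pos q_less_1 by (simp add: K_def)
  obtain i where i: "i < n" "x \<in> slot i" "\<bar>pt i\<bar> \<le> \<bar>x\<bar>" "\<bar>pt (Suc i)\<bar> \<le> \<bar>x\<bar>"
    and side: "(0 < x \<and> x = pt (Suc i)) \<or> (x < 0 \<and> x = pt i)"
    using slot_of_top_point[OF T(1) _ \<open>x \<in> T\<close>] T(2) X_facts(2) by auto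
  have x0: "x \<noteq> 0" using side by auto
  have xL: "x \<in> L" using slot_bounds(1) i(2) .
  \<comment> \<open>\<open>g Y\<close> is the point chosen in the slot of \<open>x\<close>, and \<open>h Y\<close> the configuration after the exchange\<close>
  define A where "A = {Y. interlaces q zm zp n Y X \<and> x \<notin> Y}"
  define y where "y = (\<lambda>Y. THE y. y \<in> choices \<and> Y = y ` {..<n})"
  have y: "y Y \<in> choices" "Y = y Y ` {..<n}" if "interlaces q zm zp n Y X" for Y
  proof -
    have "\<exists>!y. y \<in> choices \<and> Y = y ` {..<n}"
      using bij_betw_choices that unfolding bij_betw_def inj_on_def by blast
    from theI'[OF this] show "y Y \<in> choices" "Y = y Y ` {..<n}" by (simp_all add: y_def)
  qed
  define g where "g = (\<lambda>Y. y Y i)"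
  define h where "h = (\<lambda>Y. insert x (Y - {g Y}))"
  have gY: "g Y \<in> Y" "g Y \<in> slot i" "g Y \<noteq> x" if "Y \<in> A" for Y
    using y[of Y] that i(1) choice_in_slot[of "y Y" i] unfolding A_def g_def by auto
  have "measure_pmf.prob link_pmf {Y. x \<notin> Y} = measure_pmf.prob link_pmf A"
    using set_link_pmf by (intro measure_pmf.finite_measure_eq_AE) (auto simp: AE_measure_pmf_iff A_def)
  also have "\<dots> \<le> (pt (Suc i) - pt i) / (1 - q) * (K / \<bar>x\<bar>)"
  proof (rule prob_le_by_injection[where g = g and h = h and S = "slot i" and r = "\<lambda>v. \<bar>v\<bar> * (K / \<bar>x\<bar>)"])
    show "inj_on (\<lambda>Y. (g Y, h Y)) A"
    proof (rule inj_onI)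
      fix Y Z assume YZ: "Y \<in> A" "Z \<in> A" "(g Y, h Y) = (g Z, h Z)"
      have "W = insert (g W) (h W - {x})" if "W \<in> A" for W
        using gY[OF that] that by (auto simp: h_def A_def)
      from this[OF YZ(1)] this[OF YZ(2)] YZ(3) show "Y = Z" by simp
    qed
    show "g ` A \<subseteq> slot i" using gY by blast
    show "0 \<le> \<bar>v\<bar> * (K / \<bar>x\<bar>)" for v using K by simp
    have "((\<lambda>v. \<bar>v\<bar> * v ^ 0) has_sum (pt (Suc i) ^ Suc 0 - pt i ^ Suc 0) / (1 - q ^ Suc 0)) (slot i)"
      unfolding slot_def using i(1) by (intro has_sum_lattice_interval pt_in_L pt_less) auto
    then have "((\<lambda>v. \<bar>v\<bar>) has_sum (pt (Suc i) - pt i) / (1 - q)) (slot i)" by simp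
    then show "((\<lambda>v. \<bar>v\<bar> * (K / \<bar>x\<bar>)) has_sum (pt (Suc i) - pt i) / (1 - q) * (K / \<bar>x\<bar>)) (slot i)"
      by (rule has_sum_cmult_left)
  next
    fix Y assume Y: "Y \<in> A"
    then have YX: "interlaces q zm zp n Y X" "x \<notin> Y" by (auto simp: A_def)
    note yY = y[OF YX(1)]
    define v where "v = g Y"
    define R where "R = Y - {v}"
    note v = gY[OF Y, folded v_def]
    have fin: "finite R" and card: "card R = n - 1"
      using YX(1) v(1) by (auto simp: R_def interlaces_def G_def)
    have Yeq: "Y = insert v R" and hY: "h Y = insert x R" and notin: "v \<notin> R" "x \<notin> R"
      using v YX(2) by (auto simp: R_def h_def v_def)
    have R_sub: "R \<subseteq> y Y ` {..<n}" using yY(2) by (metis Diff_subset R_def)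
    have RX: "\<exists>j<n. j \<noteq> i \<and> r = y Y j \<and> r \<in> slot j" if r: "r \<in> R" for r
    proof -
      obtain j where j: "j < n" "r = y Y j" using r R_sub by blast
      moreover have "j \<noteq> i" using r j by (auto simp: R_def v_def g_def)
      ultimately show ?thesis using choice_in_slot[OF yY(1) j(1)] by blast
    qed
    have RL: "r \<in> L" if "r \<in> R" for r using RX[OF that] slot_bounds(1) by blast
    have vL: "v \<in> L" using slot_bounds(1) v(2) .
    have larger: "card {r \<in> R. \<bar>x\<bar> < \<bar>r\<bar>} \<le> card T"
      by (rule card_larger_le[OF T(1) \<open>x \<in> T\<close> yY(1) R_sub])
    \<comment> \<open>for negative \<open>x\<close> the estimate is applied to the reflected points\<close>
    have key: "(\<Prod>r\<in>R. \<bar>v - r\<bar>) \<le> K * (\<Prod>r\<in>R. \<bar>x - r\<bar>)"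
      using side
    proof
      assume x: "0 < x \<and> x = pt (Suc i)"
      have vx: "v < x" using slot_bounds(3)[OF v(2)] v(3) x by simp
      have vabs: "\<bar>v\<bar> \<le> x" using vx slot_bounds(2)[OF v(2)] i(3) x by simp
      have "v \<le> q * x"
      proof (cases "0 < v")
        case True
        then show ?thesis using lattice_gap[OF vL xL] vx x by simp
      next
        case False
        then show ?thesis using mult_pos_pos[of q x] q_pos x by linarith
      qed
      moreover have "r < v \<or> x \<le> q * r" if r: "r \<in> R" for r
      proof -
        obtain j where j: "j < n" "j \<noteq> i" "r \<in> slot j" using RX[OF r] by blast
        show ?thesis
        proof (cases "j < i")
          case True
          then show ?thesis using slot_less[OF True i(1) j(3) v(2)] by simp
        next
          case False
          then have "x < r" using slot_less[OF _ j(1) i(2) j(3)] j(2) by simp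
          then show ?thesis using lattice_gap[OF xL RL[OF r]] x by simp
        qed
      qed
      ultimately show ?thesis
        using prod_dist_ratio_le[OF q_pos q_less_1, of x v R "card T"] x vabs fin larger card
        by (simp add: K_def)
    next
      assume x: "x < 0 \<and> x = pt i"
      have vx: "x < v" using slot_bounds(2)[OF v(2)] v(3) x by simp
      have vabs: "\<bar>v\<bar> \<le> - x" using vx slot_bounds(3)[OF v(2)] i(4) x by simp
      have a: "- v \<le> q * - x"
      proof (cases "v < 0")
        case True
        then show ?thesis using lattice_gap[OF vL xL] vx x by (simp add: mult_neg_neg)
      next
        case False
        then show ?thesis using mult_pos_pos[of q "- x"] q_pos x by simp
      qed
      have b: "r < - v \<or> - x \<le> q * r" if r: "r \<in> uminus ` R" for r
      proof -
        obtain j where j: "j < n" "j \<noteq> i" "- r \<in> slot j" using RX[of "- r"] r by auto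
        show ?thesis
        proof (cases "i < j")
          case True
          then show ?thesis using slot_less[OF True j(1) v(2) j(3)] by simp
        next
          case False
          then have "- r < x" using slot_less[OF _ i(1) j(3) i(2)] j(2) by simp
          then show ?thesis using lattice_gap[OF xL RL, of "- r"] x r by (auto simp: mult_neg_neg)
        qed
      qed
      have "{r \<in> uminus ` R. - x < \<bar>r\<bar>} = uminus ` {r \<in> R. \<bar>x\<bar> < \<bar>r\<bar>}" using x by force
      then have c: "card {r \<in> uminus ` R. - x < \<bar>r\<bar>} \<le> card T"
        using larger by (simp add: card_image)
      have refl: "(\<Prod>r\<in>uminus ` R. \<bar>- u - r\<bar>) = (\<Prod>r\<in>R. \<bar>u - r\<bar>)" for u :: real
        by (subst prod.reindex) (auto intro!: prod.cong)
      show ?thesis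
        using prod_dist_ratio_le[OF q_pos q_less_1, of "- x" "- v" "uminus ` R" "card T"]
          a b c x vabs fin card refl[of x] refl[of v]
        by (simp add: K_def card_image)
    qed
    have "interlaces q zm zp n (h Y) X"
    proof -
      have "(y Y)(i := x) \<in> choices"
        using yY(1) i(1,2) unfolding choices_def by (auto simp: PiE_iff extensional_def)
      moreover have "((y Y)(i := x)) ` {..<n} = insert x (y Y ` ({..<n} - {i}))"
        using i(1) by auto
      moreover have "y Y ` ({..<n} - {i}) = y Y ` {..<n} - {y Y i}"
        using inj_on_image_set_diff[OF inj_on_choice[OF yY(1)], of "{..<n}" "{i}"] i(1) by simp
      then have "y Y ` ({..<n} - {i}) = R" using yY(2) by (metis R_def v_def g_def)
      ultimately show ?thesis using interlaces_choice[of "(y Y)(i := x)"] hY by simp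
    qed
    then have px: "pmf link_pmf (h Y) = \<bar>x\<bar> * (\<Prod>r\<in>R. \<bar>r\<bar>) * (\<Prod>j=1..n. 1 - q ^ j) *
        (vandermonde R * (\<Prod>r\<in>R. \<bar>x - r\<bar>) / vandermonde X)"
      unfolding pmf_link_pmf qlink_def hY using fin notin by (simp add: vandermonde_insert)
    have pv: "pmf link_pmf Y = \<bar>v\<bar> * (\<Prod>r\<in>R. \<bar>r\<bar>) * (\<Prod>j=1..n. 1 - q ^ j) *
        (vandermonde R * (\<Prod>r\<in>R. \<bar>v - r\<bar>) / vandermonde X)"
      using YX(1) fin notin unfolding pmf_link_pmf qlink_def Yeq by (simp add: vandermonde_insert)
    \<comment> \<open>the factor common to the masses of \<open>Y\<close> and \<open>h Y\<close>\<close>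
    define D where "D = (\<Prod>r\<in>R. \<bar>r\<bar>) * (\<Prod>j=1..n. 1 - q ^ j) * (vandermonde R / vandermonde X)"
    have "0 \<le> D" unfolding D_def
      using less_imp_le[OF q_factorial_pos] less_imp_le[OF vandermonde_pos[of R]] less_imp_le[OF vandermonde_pos[of X]]
      by (intro mult_nonneg_nonneg divide_nonneg_nonneg) (auto intro!: prod_nonneg[of R])
    have "pmf link_pmf Y = \<bar>v\<bar> * D * (\<Prod>r\<in>R. \<bar>v - r\<bar>)"
      unfolding pv D_def by simp
    also have "\<dots> \<le> \<bar>v\<bar> * D * (K * (\<Prod>r\<in>R. \<bar>x - r\<bar>))"
      using key \<open>0 \<le> D\<close> by (intro mult_left_mono) auto
    also have "\<dots> = \<bar>v\<bar> * (K / \<bar>x\<bar>) * (\<bar>x\<bar> * D * (\<Prod>r\<in>R. \<bar>x - r\<bar>))"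
      using x0 by simp
    also have "\<bar>x\<bar> * D * (\<Prod>r\<in>R. \<bar>x - r\<bar>) = pmf link_pmf (h Y)"
      unfolding px D_def by simp
    finally show "pmf link_pmf Y \<le> \<bar>g Y\<bar> * (K / \<bar>x\<bar>) * pmf link_pmf (h Y)"
      by (simp add: v_def)
  qed
  also have "\<dots> \<le> (2 * \<bar>x\<bar>) / (1 - q) * (K / \<bar>x\<bar>)"
    using i(3,4) K q_less_1 by (intro mult_right_mono divide_right_mono) auto
  also have "\<dots> = 2 / (1 - q) * K" using x0 by simp
  finally show ?thesis by (simp add: K_def mult.assoc)
qed

lemma prob_not_initial:
  assumes T: "initial T X" "card T < n"
  shows "measure_pmf.prob link_pmf {Y. \<not> initial T Y} \<le>
    card T * (2 / (1 - q) * (2 / (1 - q)) ^ card T * ((1 + q) / 2) ^ (n - 1 - card T))"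
proof -
  have finT: "finite T" using T X_facts(1) by (auto simp: initial_def intro: finite_subset)
  have "measure_pmf.prob link_pmf {Y. \<not> initial T Y} \<le> measure_pmf.prob link_pmf (\<Union>x\<in>T. {Y. x \<notin> Y})"
    using set_link_pmf initial_if_subset[OF T(1)]
    by (intro measure_pmf.finite_measure_mono_AE) (auto simp: AE_measure_pmf_iff)
  also have "\<dots> \<le> (\<Sum>x\<in>T. measure_pmf.prob link_pmf {Y. x \<notin> Y})"
    by (rule measure_UNION_le[OF finT]) auto
  also have "\<dots> \<le> card T * (2 / (1 - q) * (2 / (1 - q)) ^ card T * ((1 + q) / 2) ^ (n - 1 - card T))"
    by (rule sum_bounded_above) (rule prob_top_point_missing[OF T])
  finally show ?thesis .
qed

end

section \<open>Iterating the links\<close>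

context q_lattice
begin

text \<open>The tail from \<open>n\<close> on of the geometric series of one-step losses. Its successive differences are the
  bounds for single links (\<open>decay_diff\<close>), so the losses telescope; the additional factor
  \<open>2 / (1 - q)\<close> is the inverse of \<open>1 - (1 + q) / 2\<close>.\<close>

definition decay :: "nat \<Rightarrow> nat \<Rightarrow> real" where
  "decay k n = k * (2 / (1 - q)) ^ Suc k * (2 / (1 - q)) * ((1 + q) / 2) ^ (n - 1 - k)"

lemma decay_diff:
  assumes "k < n"
  shows "decay k n - decay k (Suc n) =
    k * (2 / (1 - q) * (2 / (1 - q)) ^ k * ((1 + q) / 2) ^ (n - 1 - k))"
proof -
  define c where "c = (1 + q) / 2"
  obtain m where m: "n = Suc (k + m)" using less_imp_Suc_add[OF assms] by auto
  have "2 / (1 - q) * (1 - c) = 1" using q_less_1 by (simp add: c_def field_simps)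
  then have "2 / (1 - q) * ((1 - c) * c ^ m) = c ^ m" by (simp only: mult.assoc[symmetric] mult_1_left)
  then have "2 / (1 - q) * (c ^ m - c ^ Suc m) = c ^ m" by (simp only: left_diff_distrib mult_1_left power_Suc)
  then have "real k * (2 / (1 - q)) ^ Suc k * (2 / (1 - q) * (c ^ m - c ^ Suc m)) =
    real k * (2 / (1 - q)) ^ Suc k * c ^ m" by simp
  then show ?thesis unfolding decay_def c_def[symmetric] m by (simp add: algebra_simps)
qed

lemma decay_nonneg: "0 \<le> decay k n"
  using q_pos q_less_1 by (simp add: decay_def)

lemma decay_antimono: "m \<le> n \<Longrightarrow> decay k n \<le> decay k m"
  using q_pos q_less_1 unfolding decay_def
  by (intro mult_left_mono power_decreasing mult_nonneg_nonneg) auto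

lemma decay_tendsto_0: "decay k \<longlonglongrightarrow> 0"
proof -
  have "(\<lambda>n. ((1 + q) / 2) ^ n) \<longlonglongrightarrow> 0"
    using q_pos q_less_1 by (intro LIMSEQ_power_zero) auto
  then have "(\<lambda>n. ((1 + q) / 2) ^ (n - (1 + k))) \<longlonglongrightarrow> 0"
    by (rule filterlim_compose) (rule filterlim_minus_const_nat_at_top)
  then have "(\<lambda>n. k * (2 / (1 - q)) ^ Suc k * (2 / (1 - q)) * ((1 + q) / 2) ^ (n - (1 + k))) \<longlonglongrightarrow> 0"
    by (rule tendsto_mult_right_zero)
  then show ?thesis by (simp only: decay_def[abs_def] diff_diff_left)
qed

text \<open>The product of links is again a Markov kernel, obtained by composing probability mass
  functions. The segment is missing at level \<open>K\<close> only if the first link already lost it or the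
  remaining links lose it, so the losses add up.\<close>

lemma ex_qlinks_pmf:
  assumes "K < N" "X \<in> G q zm zp N"
  shows "\<exists>p. set_pmf p \<subseteq> G q zm zp K \<and> (\<forall>Y. pmf p Y = qlinks q zm zp N K X Y) \<and>
    (\<forall>T. initial T X \<longrightarrow> card T < K \<longrightarrow>
      measure_pmf.prob p {Y. \<not> initial T Y} \<le> decay (card T) K - decay (card T) N)"
  using assms
proof (induction N arbitrary: X)
  case 0
  then show ?case by simp
next
  case (Suc n)
  interpret configuration q zm zp n X by standard (rule Suc.prems)
  have supp: "set_pmf link_pmf \<subseteq> G q zm zp n"
    using set_link_pmf by (auto simp: interlaces_def)
  have step: "measure_pmf.prob link_pmf {Y. \<not> initial T Y} \<le> decay (card T) n - decay (card T) (Suc n)"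
    if "initial T X" "card T < n" for T
    using prob_not_initial[OF that] by (simp only: decay_diff[OF that(2)])
  show ?case
  proof (cases "n = K")
    case True
    have "pmf link_pmf Y = qlinks q zm zp (Suc n) K X Y" for Y
      unfolding pmf_link_pmf using True by simp
    then show ?thesis using supp step True by (intro exI[of _ link_pmf]) blast
  next
    case False
    then have "K < n" using Suc.prems by simp
    from Suc.IH[OF this] obtain P where P: "\<And>Z. Z \<in> G q zm zp n \<Longrightarrow> set_pmf (P Z) \<subseteq> G q zm zp K"
      "\<And>Z Y. Z \<in> G q zm zp n \<Longrightarrow> pmf (P Z) Y = qlinks q zm zp n K Z Y"
      "\<And>Z T. Z \<in> G q zm zp n \<Longrightarrow> initial T Z \<Longrightarrow> card T < K \<Longrightarrow>
        measure_pmf.prob (P Z) {Y. \<not> initial T Y} \<le> decay (card T) K - decay (card T) n"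
      by metis
    let ?p = "bind_pmf link_pmf P"
    have "set_pmf ?p \<subseteq> G q zm zp K" using supp P(1) by auto
    moreover have "pmf ?p Y = qlinks q zm zp (Suc n) K X Y" for Y
    proof -
      have "pmf ?p Y = (\<Sum>\<^sub>\<infinity>Z\<in>G q zm zp n. pmf link_pmf Z * pmf (P Z) Y)"
        unfolding pmf_bind by (rule infsum_pmf_eq_expectation[symmetric, OF supp, of _ 1]) (simp add: pmf_le_1)
      also have "\<dots> = (\<Sum>\<^sub>\<infinity>Z\<in>G q zm zp n. qlink q zm zp n X Z * qlinks q zm zp n K Z Y)"
        by (rule infsum_cong) (simp add: pmf_link_pmf P(2))
      finally show ?thesis using \<open>K < n\<close> by simp
    qed
    moreover have "measure_pmf.prob ?p {Y. \<not> initial T Y} \<le> decay (card T) K - decay (card T) (Suc n)"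
      if T: "initial T X" "card T < K" for T
    proof -
      define d where "d = decay (card T) K - decay (card T) n"
      let ?A = "{Y. \<not> initial T Y}"
      have "0 \<le> d" using decay_antimono[of K n "card T"] \<open>K < n\<close> by (simp add: d_def)
      have "emeasure ?p ?A = (\<integral>\<^sup>+Z. emeasure (P Z) ?A \<partial>link_pmf)" by simp
      also have "\<dots> \<le> (\<integral>\<^sup>+Z. indicator ?A Z + ennreal d \<partial>link_pmf)"
      proof (rule nn_integral_mono_AE, unfold AE_measure_pmf_iff, rule ballI)
        fix Z assume "Z \<in> set_pmf link_pmf"
        then have Z: "Z \<in> G q zm zp n" using supp by blast
        show "emeasure (P Z) ?A \<le> indicator ?A Z + ennreal d"
        proof (cases "initial T Z")
          case True
          then show ?thesis
            using P(3)[OF Z True T(2)] by (simp add: measure_pmf.emeasure_eq_measure d_def ennreal_leI)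
        next
          case False
          have "emeasure (P Z) ?A \<le> 1" by (rule measure_pmf.emeasure_le_1)
          also have "\<dots> \<le> 1 + ennreal d" by (rule add_increasing2) auto
          finally show ?thesis using False by simp
        qed
      qed
      also have "\<dots> = emeasure link_pmf ?A + ennreal d"
        by (simp add: nn_integral_add measure_pmf.emeasure_space_1[simplified])
      also have "\<dots> = ennreal (measure_pmf.prob link_pmf ?A + d)"
        using \<open>0 \<le> d\<close> by (simp add: measure_pmf.emeasure_eq_measure)
      finally have "measure_pmf.prob ?p ?A \<le> measure_pmf.prob link_pmf ?A + d"
        using \<open>0 \<le> d\<close>
        by (simp only: measure_pmf.emeasure_eq_measure ennreal_le_iff add_nonneg_nonneg measure_nonneg)
      also have "\<dots> \<le> decay (card T) K - decay (card T) (Suc n)"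
        using step[OF T(1)] T(2) \<open>K < n\<close> by (simp add: d_def)
      finally show ?thesis .
    qed
    ultimately show ?thesis by blast
  qed
qed

text \<open>Stabilization gives the first \<open>card T\<close> terms of the variational series for large \<open>N\<close>, and these terms
  are exactly the points of an initial segment.\<close>

lemma eventually_initial:
  assumes X: "X \<in> G_inf q zm zp" and T: "initial T X" "finite T"
    and st: "stabilizes q zm zp Xs X"
  shows "\<forall>\<^sub>F N in sequentially. Xs N \<in> G q zm zp N \<and> initial T (Xs N)"
proof -
  let ?k = "card T"
  have "\<forall>\<^sub>F N in sequentially. \<forall>j\<in>{1..?k}. var_series (Xs N) j = var_series X j"
    using st by (intro eventually_ball_finite) (auto simp: stabilizes_def)
  moreover have "\<forall>\<^sub>F N in sequentially. max 1 ?k \<le> N" by (rule eventually_ge_at_top)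
  ultimately show ?thesis
  proof eventually_elim
    case (elim N)
    have XN: "Xs N \<in> G q zm zp N" using st elim by (simp add: stabilizes_def)
    then have "finite (Xs N)" "card (Xs N) = N" by (auto simp: G_def)
    then obtain S where S: "initial S (Xs N)" "finite S" "card S = ?k"
      using ex_initial[of "Xs N" ?k] elim by auto
    have "S = var_series (Xs N) ` {1..?k}" using initial_eq_var_series_image[OF S(1,2)] S(3) by simp
    also have "\<dots> = var_series X ` {1..?k}" using elim by (intro image_cong) auto
    also have "\<dots> = T" using initial_eq_var_series_image[OF T] by simp
    finally show ?case using S(1) XN by simp
  qed
qed

text \<open>The bound on the composed links is uniform in \<open>N\<close>; the indicator of the complementary event is a
  bounded test function, so the bound survives the weak limit.\<close>

lemma prob_M_not_initial:
  assumes X: "X \<in> G_inf q zm zp" and T: "initial T X" "finite T" "card T < K"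
    and M: "is_M q zm zp X K \<mu>"
  shows "measure_pmf.prob \<mu> {Y. \<not> initial T Y} \<le> decay (card T) K"
proof -
  let ?A = "{Y. \<not> initial T Y}"
  obtain Xs where st: "stabilizes q zm zp Xs X"
    and weak: "weakly_converges_on (G q zm zp K) (\<lambda>N. qlinks q zm zp N K (Xs N)) \<mu>"
    using M by (auto simp: is_M_def)
  let ?f = "indicator ?A :: real set \<Rightarrow> real"
  have "bounded (?f ` G q zm zp K)"
    by (rule bounded_subset[of "{0, 1}"]) (auto simp: indicator_def)
  with weak have lim: "(\<lambda>N. \<Sum>\<^sub>\<infinity>Y\<in>G q zm zp K. qlinks q zm zp N K (Xs N) Y * ?f Y)
      \<longlonglongrightarrow> measure_pmf.expectation \<mu> ?f"
    unfolding weakly_converges_on_def by blast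
  have "\<forall>\<^sub>F N in sequentially.
      (\<Sum>\<^sub>\<infinity>Y\<in>G q zm zp K. qlinks q zm zp N K (Xs N) Y * ?f Y) \<le> decay (card T) K"
    using eventually_initial[OF X T(1,2) st] eventually_gt_at_top[of K]
  proof eventually_elim
    case (elim N)
    then obtain p where p: "set_pmf p \<subseteq> G q zm zp K" "\<And>Y. pmf p Y = qlinks q zm zp N K (Xs N) Y"
      "measure_pmf.prob p ?A \<le> decay (card T) K - decay (card T) N"
      using ex_qlinks_pmf[of K N "Xs N"] T(3) by blast
    have "(\<Sum>\<^sub>\<infinity>Y\<in>G q zm zp K. qlinks q zm zp N K (Xs N) Y * ?f Y) = measure_pmf.expectation p ?f"
      unfolding p(2)[symmetric] by (rule infsum_pmf_eq_expectation[OF p(1), of _ 1]) (simp add: indicator_def)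
    then show ?case using p(3) decay_nonneg[of "card T" N] by simp
  qed
  then have "measure_pmf.expectation \<mu> ?f \<le> decay (card T) K"
    by (intro tendsto_upperbound[OF lim]) auto
  then show ?thesis by simp
qed

end

theorem theorem3p11:
  fixes q zm zp :: real
    and X :: "real set"
    and M :: "nat \<Rightarrow> real set pmf"
    and k :: nat
  assumes "0 < q" and "q < 1" and "zm < 0" and "0 < zp"
    and "X \<in> G_inf q zm zp"
    and "\<And>L. L \<ge> 1 \<Longrightarrow> is_M q zm zp X L (M L)"
    and "k \<ge> 1"
  shows "(\<lambda>L. measure_pmf.prob (M L) {Y. var_series Y k = var_series X k}) \<longlonglongrightarrow> 1"
proof -
  interpret q_lattice q zm zp by standard (use assms in auto)
  obtain T where T: "initial T X" "finite T" "card T = k"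
    using ex_initial[of X k] finite_before assms(5) by (auto simp: G_inf_def)
  have lower: "1 - decay k L \<le> measure_pmf.prob (M L) {Y. var_series Y k = var_series X k}"
    if "k < L" for L
  proof -
    have "1 - decay k L \<le> 1 - measure_pmf.prob (M L) {Y. \<not> initial T Y}"
      using prob_M_not_initial[OF assms(5) T(1,2), of L "M L"] assms(6)[of L] T(3) that by simp
    also have "\<dots> = measure_pmf.prob (M L) {Y. initial T Y}"
      using measure_pmf.prob_compl[of "{Y. \<not> initial T Y}" "M L"] by (simp add: Compl_eq_Diff_UNIV[symmetric] Collect_neg_eq[symmetric])
    also have "\<dots> \<le> measure_pmf.prob (M L) {Y. var_series Y k = var_series X k}"
      using var_series_eq_initial[OF _ T(2)] T assms(7)
      by (intro measure_pmf.finite_measure_mono) auto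
    finally show ?thesis .
  qed
  have "(\<lambda>L. 1 - decay k L) \<longlonglongrightarrow> 1 - 0"
    by (intro tendsto_intros decay_tendsto_0)
  then have "(\<lambda>L. 1 - decay k L) \<longlonglongrightarrow> 1" by simp
  then show ?thesis
  proof (rule tendsto_sandwich[rotated 2])
    show "\<forall>\<^sub>F L in sequentially.
        1 - decay k L \<le> measure_pmf.prob (M L) {Y. var_series Y k = var_series X k}"
      using eventually_gt_at_top[of k] by eventually_elim (rule lower)
  qed (auto intro: tendsto_const)
qed

end
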